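(* Let $A\in\mathbb{R}^{m\times n}$ with $m>n$, let $1\le k\le n$, and consider a $k$-step Lanczos bidiagonalization with reorthogonalization (LBRO) of $A$ computed in finite precision arithmetic with roundoff unit $\mathbf{u}$, with orthogonality levels $\mu_{k+1}<1/2$ and $\nu_k<1/2$. For $1\le i\le k+1$ let $$p_i=\begin{pmatrix}-e_i^{(n+1)}\\ u_i\end{pmatrix}\in\mathbb{R}^{m+n+1},\qquad P_i=I_{m+n+1}-p_ip_i^T,\qquad \widehat P_{i}=P_1\cdots P_{i},$$ and for $1\le i\le k$ let $$x_i=\widehat P_{i+1}\begin{pmatrix}\alpha_ie_i^{(i)}\\ \beta_{i+1}e_1^{(m+n-i+1)}\end{pmatrix}-\begin{pmatrix}0_{n+1}\\ Av_i\end{pmatrix}\in\mathbb{R}^{m+n+1}.$$ Then, with $X_k=(x_1,\dots,x_k)$ and $s=m+n-k$, $$\begin{pmatrix}O_{(n+1)\times k}\\ AV_k\end{pmatrix}+X_k=\widehat P_{k+1}\begin{pmatrix}B_k\\ O_{s\times k}\end{pmatrix},$$ and $$\|X_k\|=O\big(\|A\|\sqrt k\,(k\mathbf{u}+k\nu_k+\mu_{k+1})\big).$$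
   Context: $\|\cdot\|$ is the vector or matrix 2-norm, $e_i^{(l)}$ is the $i$-th column of the identity matrix $I_l$, $O_{p\times q}$ is the $p\times q$ zero matrix, and $0_l$ is the zero vector of dimension $l$. The roundoff unit $\mathbf{u}$ is a small positive number. Model of the $k$-step LBRO of $A\in\mathbb{R}^{m\times n}$ in finite precision arithmetic: it produces real vectors of unit length $u_1,\dots,u_{k+1}\in\mathbb{R}^m$, $v_1,\dots,v_{k+1}\in\mathbb{R}^n$, positive numbers $\alpha_1,\dots,\alpha_{k+1}$, $\beta_1,\dots,\beta_{k+1}$, and arbitrary real reorthogonalization coefficients $\xi_{ji}$ ($1\le j\le i\le k$), $\eta_{ji}$ ($1\le j\le i-1$, $i\le k+1$) (some may be zero), such that, with $v_0=0$, $$Av_i=\alpha_iu_i+\beta_{i+1}u_{i+1}+\sum_{j=1}^{i}\xi_{ji}u_j+f_i\quad(1\le i\le k),$$ $$A^Tu_i=\alpha_iv_i+\beta_iv_{i-1}+\sum_{j=1}^{i-1}\eta_{ji}v_j+g_i\quad(1\le i\le k+1),$$ where the rounding error terms satisfy $\|F_k\|=O(\|A\|\mathbf{u})$ for $F_k=(f_1,\dots,f_k)$ and $\|G_{k+1}\|=O(\|A\|\mathbf{u})$ for $G_{k+1}=(g_1,\dots,g_{k+1})$. Put $U_i=(u_1,\dots,u_i)$, $V_i=(v_1,\dots,v_i)$, and let $B_k\in\mathbb{R}^{(k+1)\times k}$ be the lower bidiagonal matrix with diagonal entries $\alpha_1,\dots,\alpha_k$ and subdiagonal entries $\beta_2,\dots,\beta_{k+1}$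 (entry $(i+1,i)$ equals $\beta_{i+1}$). Orthogonality levels: $\mu_i=\|\mathbf{SUT}(I_i-U_i^TU_i)\|$, $\nu_i=\|\mathbf{SUT}(I_i-V_i^TV_i)\|$, where $\mathbf{SUT}(\cdot)$ denotes the strictly upper triangular part of a matrix. $O$-convention: bounds are to first order in the small quantities $\mathbf{u}$ and the orthogonality levels. If $K$ is a constant such that the assumed rounding error bounds hold with $O(z)$ replaced by $Kz$, then a conclusion $y=O(z)$ means that there are constants $C,\varepsilon_0>0$ depending only on $K$ such that $|y|\le Cz$ whenever $\mathbf{u}$, $\mu_{k+1}$ and $\nu_k$ are at most $\varepsilon_0$. *)

theory Defs
  imports Complex_Main "Jordan_Normal_Form.Matrix"
begin

text \<open>Vectors and matrices are those of the library, with explicit dimensions, because the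
  constants hidden in the \<open>O\<close>-bounds must not depend on the dimensions. Families of vectors and
  scalars are indexed from 1 as in the mathematics, whereas the entries of vectors and matrices are
  indexed from 0; so \<open>unit_vec d (i - 1)\<close> is the \<open>i\<close>-th column of the identity
  matrix of size \<open>d\<close>.\<close>

definition vec_norm :: "real vec \<Rightarrow> real" where
  "vec_norm x = sqrt (x \<bullet> x)"

text \<open>The operator norm induced by the Euclidean norm; as in \<open>onorm\<close>, the zero vector
  contributes \<open>0 / 0 = 0\<close>.\<close>

definition mat_norm :: "real mat \<Rightarrow> real" where
  "mat_norm M = (SUP x \<in> carrier_vec (dim_col M). vec_norm (M *\<^sub>v x) / vec_norm x)"

definition strict_upper :: "real mat \<Rightarrow> real mat" where
  "strict_upper M = mat (dim_row M) (dim_col M) (\<lambda>(i, j). if i < j then M $$ (i, j) else 0)"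

text \<open>The matrix with the \<open>i\<close> columns \<open>w 1, \<dots>, w i\<close> of dimension \<open>d\<close>.\<close>

definition col_mat :: "nat \<Rightarrow> (nat \<Rightarrow> real vec) \<Rightarrow> nat \<Rightarrow> real mat" where
  "col_mat d w i = mat_of_cols d (map w [1..<i + 1])"

definition orth_level :: "nat \<Rightarrow> (nat \<Rightarrow> real vec) \<Rightarrow> nat \<Rightarrow> real" where
  "orth_level d w i =
     mat_norm (strict_upper (1\<^sub>m i - transpose_mat (col_mat d w i) * col_mat d w i))"

text \<open>The relations satisfied by the output of \<open>k\<close> steps. The coefficients
  \<open>\<xi> j i\<close> and \<open>\<eta> j i\<close> are unconstrained; \<open>f i\<close> and \<open>g i\<close> are the
  rounding errors, whose size is bounded separately.\<close>

definition lbro ::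
  "nat \<Rightarrow> nat \<Rightarrow> nat \<Rightarrow> real mat \<Rightarrow> (nat \<Rightarrow> real vec) \<Rightarrow> (nat \<Rightarrow> real vec) \<Rightarrow>
   (nat \<Rightarrow> real) \<Rightarrow> (nat \<Rightarrow> real) \<Rightarrow> (nat \<Rightarrow> nat \<Rightarrow> real) \<Rightarrow> (nat \<Rightarrow> nat \<Rightarrow> real) \<Rightarrow>
   (nat \<Rightarrow> real vec) \<Rightarrow> (nat \<Rightarrow> real vec) \<Rightarrow> bool" where
  "lbro m n k A u v \<alpha> \<beta> \<xi> \<eta> f g \<longleftrightarrow>
     A \<in> carrier_mat m n \<and>
     v 0 = 0\<^sub>v n \<and>
     (\<forall>i\<in>{1..k + 1}. u i \<in> carrier_vec m \<and> vec_norm (u i) = 1) \<and>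
     (\<forall>i\<in>{1..k + 1}. v i \<in> carrier_vec n \<and> vec_norm (v i) = 1) \<and>
     (\<forall>i\<in>{1..k + 1}. \<alpha> i > 0 \<and> \<beta> i > 0) \<and>
     (\<forall>i\<in>{1..k}. f i \<in> carrier_vec m) \<and>
     (\<forall>i\<in>{1..k + 1}. g i \<in> carrier_vec n) \<and>
     (\<forall>i\<in>{1..k}.
        A *\<^sub>v v i = \<alpha> i \<cdot>\<^sub>v u i + \<beta> (i + 1) \<cdot>\<^sub>v u (i + 1)
          + finsum_vec TYPE(real) m (\<lambda>j. \<xi> j i \<cdot>\<^sub>v u j) {1..i} + f i) \<and>
     (\<forall>i\<in>{1..k + 1}.
        transpose_mat A *\<^sub>v u i = \<alpha> i \<cdot>\<^sub>v v i + \<beta> i \<cdot>\<^sub>v v (i - 1)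
          + finsum_vec TYPE(real) n (\<lambda>j. \<eta> j i \<cdot>\<^sub>v v j) {1..i - 1} + g i)"

text \<open>In 0-based indexing, row \<open>j + 1\<close> of column \<open>j\<close> holds \<open>\<beta> (j + 2)\<close>.\<close>

definition bidiag :: "(nat \<Rightarrow> real) \<Rightarrow> (nat \<Rightarrow> real) \<Rightarrow> nat \<Rightarrow> real mat" where
  "bidiag \<alpha> \<beta> k = mat (k + 1) k
     (\<lambda>(i, j). if i = j then \<alpha> (j + 1) else if i = j + 1 then \<beta> (j + 2) else 0)"

definition p_vec :: "nat \<Rightarrow> (nat \<Rightarrow> real vec) \<Rightarrow> nat \<Rightarrow> real vec" where
  "p_vec n u i = - unit_vec (n + 1) (i - 1) @\<^sub>v u i"

definition P_mat :: "nat \<Rightarrow> nat \<Rightarrow> (nat \<Rightarrow> real vec) \<Rightarrow> nat \<Rightarrow> real mat" where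
  "P_mat m n u i =
     1\<^sub>m (m + n + 1) -
     mat_of_cols (m + n + 1) [p_vec n u i] * transpose_mat (mat_of_cols (m + n + 1) [p_vec n u i])"

primrec P_hat :: "nat \<Rightarrow> nat \<Rightarrow> (nat \<Rightarrow> real vec) \<Rightarrow> nat \<Rightarrow> real mat" where
  "P_hat m n u 0 = 1\<^sub>m (m + n + 1)"
| "P_hat m n u (Suc i) = P_hat m n u i * P_mat m n u (Suc i)"

definition x_vec ::
  "nat \<Rightarrow> nat \<Rightarrow> real mat \<Rightarrow> (nat \<Rightarrow> real vec) \<Rightarrow> (nat \<Rightarrow> real vec) \<Rightarrow>
   (nat \<Rightarrow> real) \<Rightarrow> (nat \<Rightarrow> real) \<Rightarrow> nat \<Rightarrow> real vec" where
  "x_vec m n A u v \<alpha> \<beta> i =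
     P_hat m n u (i + 1) *\<^sub>v
       ((\<alpha> i \<cdot>\<^sub>v unit_vec i (i - 1)) @\<^sub>v (\<beta> (i + 1) \<cdot>\<^sub>v unit_vec (m + n - i + 1) 0))
     - (0\<^sub>v (n + 1) @\<^sub>v (A *\<^sub>v v i))"

definition X_mat ::
  "nat \<Rightarrow> nat \<Rightarrow> real mat \<Rightarrow> (nat \<Rightarrow> real vec) \<Rightarrow> (nat \<Rightarrow> real vec) \<Rightarrow>
   (nat \<Rightarrow> real) \<Rightarrow> (nat \<Rightarrow> real) \<Rightarrow> nat \<Rightarrow> real mat" where
  "X_mat m n A u v \<alpha> \<beta> k = col_mat (m + n + 1) (x_vec m n A u v \<alpha> \<beta>) k"

end

theory Submission
  imports Defs "HOL-Analysis.L2_Norm"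
begin

text \<open>Put \<open>U = U\<^sub>k\<^sub>+\<^sub>1\<close>, \<open>V = V\<^sub>k\<close>, \<open>B = B\<^sub>k\<close>, \<open>S = SUT(I - U\<^sup>T U)\<close>, \<open>T = SUT(I - V\<^sup>T V)\<close>. The product of
  the reflections acts as modified Gram-Schmidt: it maps \<open>(B; 0)\<close> to \<open>(Z; 0; U (B - Z))\<close>, where
  \<open>Z = S (Z - B)\<close> is of size \<open>\<mu> \<parallel>B\<parallel>\<close>. The recurrence is \<open>A V = U (B + D) + F\<close> with \<open>D\<close> the upper
  triangular matrix of the \<open>\<xi>\<close>, so \<open>X = (Z; 0; - U (Z + D) - F)\<close> and it remains to bound \<open>D\<close>.
  The other recurrence is \<open>A\<^sup>T U\<^sub>k = V C + G\<close> with \<open>C\<close> upper triangular. Comparing the upper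
  triangles of \<open>U\<^sup>T (A V)\<close> and \<open>(A\<^sup>T U)\<^sup>T V\<close> shows that \<open>D\<close> is the upper triangle of
  \<open>(S + S\<^sup>T) (B + D) - C\<^sup>T T + G\<^sup>T V - U\<^sup>T F\<close>. Since \<open>U\<close> and \<open>V\<close> are well conditioned,
  \<open>B + D\<close> and \<open>C\<close> have Frobenius norm \<open>O(\<surd>k \<parallel>A\<parallel>)\<close>, and all estimates are made in the Frobenius
  norm.\<close>

section \<open>Euclidean, Frobenius and operator norms\<close>

lemma vec_norm_L2_set: "vec_norm x = L2_set (\<lambda>i. x $ i) {..<dim_vec x}"
  by (simp add: vec_norm_def L2_set_def scalar_prod_def power2_eq_square lessThan_atLeast0)

lemma vec_norm_nonneg [simp]: "0 \<le> vec_norm x"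
  by (simp add: vec_norm_L2_set)

lemma vec_norm_power2: "(vec_norm x)\<^sup>2 = x \<bullet> x"
  by (simp add: vec_norm_def scalar_prod_def sum_nonneg)

lemma vec_norm_power2_sum: "(vec_norm x)\<^sup>2 = (\<Sum>i<dim_vec x. (x $ i)\<^sup>2)"
  by (simp add: vec_norm_L2_set L2_set_def sum_nonneg)

lemma vec_norm_zero [simp]: "vec_norm (0\<^sub>v n) = 0"
  by (simp add: vec_norm_def)

lemma vec_norm_unit [simp]: "i < n \<Longrightarrow> vec_norm (unit_vec n i) = 1"
  by (simp add: vec_norm_def)

lemma scalar_prod_abs_le:
  assumes "dim_vec x = dim_vec y"
  shows "\<bar>x \<bullet> y\<bar> \<le> vec_norm x * vec_norm y"
proof -
  have "\<bar>x \<bullet> y\<bar> \<le> (\<Sum>i\<in>{..<dim_vec y}. \<bar>x $ i\<bar> * \<bar>y $ i\<bar>)"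
    unfolding scalar_prod_def lessThan_atLeast0 abs_mult[symmetric] by (rule sum_abs)
  also have "\<dots> \<le> vec_norm x * vec_norm y"
    unfolding vec_norm_L2_set assms by (rule L2_set_mult_ineq)
  finally show ?thesis .
qed

section \<open>The Frobenius norm\<close>

definition fro_norm :: "real mat \<Rightarrow> real" where
  "fro_norm M = L2_set (\<lambda>p. M $$ p) ({..<dim_row M} \<times> {..<dim_col M})"

lemma fro_norm_nonneg [simp]: "0 \<le> fro_norm M"
  by (simp add: fro_norm_def)

lemma fro_norm_power2:
  "(fro_norm M)\<^sup>2 = (\<Sum>i<dim_row M. \<Sum>j<dim_col M. (M $$ (i, j))\<^sup>2)"
  by (simp add: fro_norm_def L2_set_def sum_nonneg sum.cartesian_product split_def)

lemma fro_norm_power2_rows: "(fro_norm M)\<^sup>2 = (\<Sum>i<dim_row M. (vec_norm (row M i))\<^sup>2)"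
  by (simp add: fro_norm_power2 vec_norm_power2_sum)

lemma fro_norm_power2_cols: "(fro_norm M)\<^sup>2 = (\<Sum>j<dim_col M. (vec_norm (col M j))\<^sup>2)"
  unfolding fro_norm_power2
  by (subst sum.swap)
     (simp add: vec_norm_power2_sum)

lemma fro_norm_zero [simp]: "fro_norm (0\<^sub>m r c) = 0"
  unfolding fro_norm_def by (rule L2_set_0') auto

lemma fro_norm_transpose [simp]: "fro_norm (transpose_mat M) = fro_norm M"
  by (rule power2_eq_imp_eq) (auto simp: fro_norm_power2_rows[of M] fro_norm_power2_cols[of "transpose_mat M"])

lemma fro_norm_uminus [simp]: "fro_norm (- M) = fro_norm M"
  by (rule power2_eq_imp_eq) (auto simp: fro_norm_power2)

lemma fro_norm_add_le:
  assumes "M \<in> carrier_mat r c" "N \<in> carrier_mat r c"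
  shows "fro_norm (M + N) \<le> fro_norm M + fro_norm N"
proof -
  have "fro_norm (M + N) = L2_set (\<lambda>p. M $$ p + N $$ p) ({..<r} \<times> {..<c})"
    unfolding fro_norm_def using assms by (intro L2_set_cong) auto
  also have "\<dots> \<le> fro_norm M + fro_norm N"
    using L2_set_triangle_ineq[of "\<lambda>p. M $$ p" "\<lambda>p. N $$ p"] assms by (simp add: fro_norm_def)
  finally show ?thesis .
qed

lemma fro_norm_diff_le:
  assumes "M \<in> carrier_mat r c" "N \<in> carrier_mat r c"
  shows "fro_norm (M - N) \<le> fro_norm M + fro_norm N"
  using fro_norm_add_le[of M r c "- N"] assms by (simp add: minus_add_uminus_mat)

lemma fro_norm_le_of_cols:
  assumes "0 \<le> c" "\<And>j. j < dim_col M \<Longrightarrow> vec_norm (col M j) \<le> c"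
  shows "fro_norm M \<le> sqrt (real (dim_col M)) * c"
proof (rule power2_le_imp_le)
  have "(fro_norm M)\<^sup>2 \<le> (\<Sum>j<dim_col M. c\<^sup>2)"
    unfolding fro_norm_power2_cols by (intro sum_mono power_mono) (auto simp: assms)
  then show "(fro_norm M)\<^sup>2 \<le> (sqrt (real (dim_col M)) * c)\<^sup>2"
    by (simp add: power_mult_distrib)
qed (use assms in auto)

lemma L2_set_subset_mono:
  "finite B \<Longrightarrow> A \<subseteq> B \<Longrightarrow> L2_set f A \<le> L2_set f B"
  by (auto simp: L2_set_def intro!: sum_mono2)

text \<open>This is why \<open>fro_norm\<close> is an \<open>L2_set\<close> over index pairs:
  passing to the upper triangle of a matrix only shrinks the index set.\<close>

lemma L2_set_le_fro_norm:
  "A \<subseteq> {..<dim_row M} \<times> {..<dim_col M} \<Longrightarrow> L2_set (\<lambda>p. M $$ p) A \<le> fro_norm M"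
  unfolding fro_norm_def by (rule L2_set_subset_mono) auto

lemma vec_norm_mult_le_fro:
  assumes "x \<in> carrier_vec (dim_col M)"
  shows "vec_norm (M *\<^sub>v x) \<le> fro_norm M * vec_norm x"
proof (rule power2_le_imp_le)
  have "(vec_norm (M *\<^sub>v x))\<^sup>2 = (\<Sum>i<dim_row M. \<bar>row M i \<bullet> x\<bar>\<^sup>2)"
    by (simp add: vec_norm_power2_sum)
  also have "\<dots> \<le> (\<Sum>i<dim_row M. (vec_norm (row M i) * vec_norm x)\<^sup>2)"
    using assms by (intro sum_mono power_mono scalar_prod_abs_le) auto
  also have "\<dots> = (fro_norm M * vec_norm x)\<^sup>2"
    by (simp add: power_mult_distrib fro_norm_power2_rows sum_distrib_right)
  finally show "(vec_norm (M *\<^sub>v x))\<^sup>2 \<le> (fro_norm M * vec_norm x)\<^sup>2" .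
qed auto

text \<open>The supremum of a real set bounds its members only if the set is bounded; here the
  Frobenius norm is a bound, by Cauchy-Schwarz on each row. Vectors of norm zero contribute the
  quotient 0.\<close>

lemma mat_norm_bdd_above:
  "bdd_above ((\<lambda>x. vec_norm (M *\<^sub>v x) / vec_norm x) ` carrier_vec (dim_col M))"
proof (rule bdd_aboveI2[of _ _ "fro_norm M"])
  fix x :: "real vec" assume "x \<in> carrier_vec (dim_col M)"
  then show "vec_norm (M *\<^sub>v x) / vec_norm x \<le> fro_norm M"
    using vec_norm_mult_le_fro[of x M] vec_norm_nonneg[of x]
    by (cases "vec_norm x = 0") (simp_all add: divide_le_eq less_le)
qed

lemma vec_norm_mult_le:
  assumes "x \<in> carrier_vec (dim_col M)"
  shows "vec_norm (M *\<^sub>v x) \<le> mat_norm M * vec_norm x"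
proof (cases "vec_norm x = 0")
  case True
  then have "vec_norm (M *\<^sub>v x) \<le> 0"
    using vec_norm_mult_le_fro[OF assms] by simp
  then show ?thesis using True by simp
next
  case False
  then have "vec_norm x > 0" using vec_norm_nonneg[of x] by linarith
  moreover have "vec_norm (M *\<^sub>v x) / vec_norm x \<le> mat_norm M"
    unfolding mat_norm_def by (rule cSUP_upper[OF assms mat_norm_bdd_above])
  ultimately show ?thesis by (simp add: field_simps)
qed

lemma mat_norm_nonneg [simp]: "0 \<le> mat_norm M"
proof -
  have "vec_norm (M *\<^sub>v 0\<^sub>v (dim_col M)) / vec_norm (0\<^sub>v (dim_col M)) \<le> mat_norm M"
    unfolding mat_norm_def by (rule cSUP_upper[OF _ mat_norm_bdd_above]) simp
  then show ?thesis by simp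
qed

lemma mat_norm_le:
  assumes "0 \<le> c"
    and "\<And>x. x \<in> carrier_vec (dim_col M) \<Longrightarrow> vec_norm (M *\<^sub>v x) \<le> c * vec_norm x"
  shows "mat_norm M \<le> c"
  unfolding mat_norm_def
proof (rule cSUP_least)
  show "(carrier_vec (dim_col M) :: real vec set) \<noteq> {}" using zero_carrier_vec by blast
  fix x :: "real vec" assume "x \<in> carrier_vec (dim_col M)"
  then show "vec_norm (M *\<^sub>v x) / vec_norm x \<le> c"
    using assms vec_norm_nonneg[of x] by (cases "vec_norm x = 0") (simp_all add: divide_le_eq less_le)
qed

lemma mat_norm_le_fro: "mat_norm M \<le> fro_norm M"
  by (rule mat_norm_le) (auto simp: vec_norm_mult_le_fro)

text \<open>With z the image of y under the transpose, |z|^2 is the scalar product of y and M z,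
  hence at most |y| |M| |z|; one factor |z| cancels.\<close>

lemma mat_norm_transpose_le: "mat_norm (transpose_mat M) \<le> mat_norm M"
proof (rule mat_norm_le)
  fix y :: "real vec" assume "y \<in> carrier_vec (dim_col (transpose_mat M))"
  then have y: "y \<in> carrier_vec (dim_row M)" by simp
  let ?z = "transpose_mat M *\<^sub>v y"
  have z: "?z \<in> carrier_vec (dim_col M)" by (rule carrier_vecI) simp
  have "(vec_norm ?z)\<^sup>2 = y \<bullet> (M *\<^sub>v ?z)"
    unfolding vec_norm_power2 by (rule transpose_vec_mult_scalar[OF _ z y]) auto
  also have "\<dots> \<le> vec_norm y * vec_norm (M *\<^sub>v ?z)"
    using scalar_prod_abs_le[of y "M *\<^sub>v ?z"] y by auto
  also have "\<dots> \<le> vec_norm y * (mat_norm M * vec_norm ?z)"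
    by (intro mult_left_mono vec_norm_mult_le z) auto
  finally have "vec_norm ?z * vec_norm ?z \<le> (mat_norm M * vec_norm y) * vec_norm ?z"
    by (simp add: power2_eq_square ac_simps)
  then show "vec_norm ?z \<le> mat_norm M * vec_norm y"
    using vec_norm_nonneg[of ?z] mult_le_cancel_right[of "vec_norm ?z" "vec_norm ?z"]
    by (cases "vec_norm ?z = 0") simp_all
qed simp

text \<open>Each column of the product is \<open>M\<close> applied to a column of \<open>N\<close>.
  Measuring only one factor in the Frobenius norm avoids further dimension factors, and the free
  bound \<open>b\<close> lets a numerical constant stand in for \<open>mat_norm M\<close>.\<close>

lemma fro_norm_mult_le:
  assumes "M \<in> carrier_mat r n" "N \<in> carrier_mat n c" "mat_norm M \<le> b"
  shows "fro_norm (M * N) \<le> b * fro_norm N"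
proof (rule power2_le_imp_le)
  have b: "0 \<le> b" using mat_norm_nonneg[of M] assms(3) by linarith
  have "vec_norm (M *\<^sub>v x) \<le> b * vec_norm x" if "x \<in> carrier_vec n" for x
  proof -
    have "vec_norm (M *\<^sub>v x) \<le> mat_norm M * vec_norm x"
      using assms(1) that by (intro vec_norm_mult_le) auto
    also have "\<dots> \<le> b * vec_norm x"
      by (intro mult_right_mono assms) simp
    finally show ?thesis .
  qed
  then have "(\<Sum>j<c. (vec_norm (M *\<^sub>v col N j))\<^sup>2) \<le> (\<Sum>j<c. (b * vec_norm (col N j))\<^sup>2)"
    using assms(2) by (intro sum_mono power_mono) auto
  also have "\<dots> = (b * fro_norm N)\<^sup>2"
    using assms(2) by (simp add: fro_norm_power2_cols power_mult_distrib sum_distrib_left)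
  finally show "(fro_norm (M * N))\<^sup>2 \<le> (b * fro_norm N)\<^sup>2"
    using assms(1,2) by (simp add: fro_norm_power2_cols col_mult2[OF assms(1,2)] del: col_mult)
  show "0 \<le> b * fro_norm N" using b by simp
qed

lemma fro_norm_mult_le_right:
  assumes "M \<in> carrier_mat r n" "N \<in> carrier_mat n c" "mat_norm N \<le> b"
  shows "fro_norm (M * N) \<le> b * fro_norm M"
proof -
  have "fro_norm (M * N) = fro_norm (transpose_mat N * transpose_mat M)"
    using transpose_mult[OF assms(1,2)] fro_norm_transpose[of "M * N"] by simp
  also have "\<dots> \<le> b * fro_norm (transpose_mat M)"
    using assms mat_norm_transpose_le[of N]
    by (intro fro_norm_mult_le[of _ c n _ r]) auto
  finally show ?thesis by simp
qed

text \<open>Read columnwise, a lower bound for the action of \<open>M\<close> on vectors controls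
  \<open>N\<close> by the product; this later bounds the coefficient matrices through
  \<open>U E\<close> and \<open>V C\<close>.\<close>

lemma fro_norm_le_mult:
  assumes M: "M \<in> carrier_mat r n" and N: "N \<in> carrier_mat n c" and "0 \<le> a"
    and low: "\<And>x. x \<in> carrier_vec n \<Longrightarrow> vec_norm x \<le> a * vec_norm (M *\<^sub>v x)"
  shows "fro_norm N \<le> a * fro_norm (M * N)"
proof (rule power2_le_imp_le)
  have "(fro_norm N)\<^sup>2 \<le> (\<Sum>j<c. (a * vec_norm (M *\<^sub>v col N j))\<^sup>2)"
    unfolding fro_norm_power2_cols using N low by (auto intro!: sum_mono power_mono)
  also have "\<dots> = a\<^sup>2 * (\<Sum>j<c. (vec_norm (col (M * N) j))\<^sup>2)"
    using col_mult2[OF M N] by (simp add: power_mult_distrib sum_distrib_left)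
  also have "\<dots> = (a * fro_norm (M * N))\<^sup>2"
    using N by (simp add: fro_norm_power2_cols power_mult_distrib)
  finally show "(fro_norm N)\<^sup>2 \<le> (a * fro_norm (M * N))\<^sup>2" .
qed (use assms in auto)

section \<open>Row-stacked block matrices\<close>

lemma append_rows_index:
  assumes "A \<in> carrier_mat r c" "B \<in> carrier_mat r' c" "i < r + r'" "j < c"
  shows "(A @\<^sub>r B) $$ (i, j) = (if i < r then A $$ (i, j) else B $$ (i - r, j))"
  using assms by (auto simp: append_rows_def)

lemma append_rows3_index:
  assumes A: "A \<in> carrier_mat r c" and B: "B \<in> carrier_mat r' c" and C: "C \<in> carrier_mat r'' c"
    and ij: "i < r + r' + r''" "j < c"
  shows "(A @\<^sub>r (B @\<^sub>r C)) $$ (i, j) =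
    (if i < r then A $$ (i, j) else if i < r + r' then B $$ (i - r, j) else C $$ (i - (r + r'), j))"
proof -
  have "i - r - r' = i - (r + r')" by simp
  then show ?thesis
    using append_rows_index[OF A carrier_append_rows[OF B C], of i j]
      append_rows_index[OF B C, of "i - r" j] ij
    by auto
qed

text \<open>The squares of the norms add exactly; the sum of the norms is a cruder bound that is
  enough here.\<close>

lemma fro_norm_append_rows:
  assumes A: "A \<in> carrier_mat r c" and B: "B \<in> carrier_mat r' c"
  shows "fro_norm (A @\<^sub>r B) \<le> fro_norm A + fro_norm B"
proof (rule power2_le_imp_le)
  have AB: "A @\<^sub>r B \<in> carrier_mat (r + r') c"
    using A B by simp
  have "(fro_norm (A @\<^sub>r B))\<^sup>2 = (\<Sum>i<r + r'. \<Sum>j<c. ((A @\<^sub>r B) $$ (i, j))\<^sup>2)"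
    using AB by (simp add: fro_norm_power2)
  also have "\<dots> = (\<Sum>i<r. \<Sum>j<c. ((A @\<^sub>r B) $$ (i, j))\<^sup>2)
      + (\<Sum>i<r'. \<Sum>j<c. ((A @\<^sub>r B) $$ (i + r, j))\<^sup>2)"
    by (induction r') (simp_all add: ac_simps)
  also have "\<dots> = (fro_norm A)\<^sup>2 + (fro_norm B)\<^sup>2"
    using A B by (simp add: fro_norm_power2 append_rows_index[OF A B])
  also have "\<dots> \<le> (fro_norm A + fro_norm B)\<^sup>2"
    by (simp add: power2_sum)
  finally show "(fro_norm (A @\<^sub>r B))\<^sup>2 \<le> (fro_norm A + fro_norm B)\<^sup>2" .
qed simp

section \<open>Gram matrices of nearly orthonormal columns\<close>

lemma col_mat_carrier [simp]: "col_mat d w N \<in> carrier_mat d N"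
  by (auto simp: col_mat_def mat_of_cols_def)

lemma col_mat_dim [simp]: "dim_row (col_mat d w N) = d" "dim_col (col_mat d w N) = N"
  by (auto simp: carrier_matD[OF col_mat_carrier])

lemma col_mat_index [simp]:
  "i < d \<Longrightarrow> j < N \<Longrightarrow> col_mat d w N $$ (i, j) = w (j + 1) $ i"
  by (simp add: col_mat_def mat_of_cols_index del: upt_Suc)

lemma col_col_mat:
  "j < N \<Longrightarrow> w (j + 1) \<in> carrier_vec d \<Longrightarrow> col (col_mat d w N) j = w (j + 1)"
  by (auto simp: vec_eq_iff)

lemma vec_norm_le_mat_norm_col_mat:
  assumes "j < N" "w (j + 1) \<in> carrier_vec d"
  shows "vec_norm (w (j + 1)) \<le> mat_norm (col_mat d w N)"
proof -
  have "vec_norm (col_mat d w N *\<^sub>v unit_vec N j) \<le> mat_norm (col_mat d w N) * 1"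
    using vec_norm_mult_le[of "unit_vec N j" "col_mat d w N"] assms by simp
  moreover have "col_mat d w N *\<^sub>v unit_vec N j = w (j + 1)"
    using col_mult2[OF col_mat_carrier one_carrier_mat assms(1), of d w] assms
    by (simp add: right_mult_one_mat[OF col_mat_carrier] col_col_mat)
  ultimately show ?thesis by simp
qed

text \<open>The matrix whose norm is \<open>orth_level\<close>. The argument works with the matrix
  itself, as \<open>S\<close> for the family \<open>u\<close> and as \<open>T\<close> for the family
  \<open>v\<close>.\<close>

definition gram_defect :: "nat \<Rightarrow> (nat \<Rightarrow> real vec) \<Rightarrow> nat \<Rightarrow> real mat" where
  "gram_defect d w N = strict_upper (1\<^sub>m N - transpose_mat (col_mat d w N) * col_mat d w N)"

lemma gram_defect_carrier [simp]: "gram_defect d w N \<in> carrier_mat N N"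
  by (auto simp: gram_defect_def strict_upper_def)

lemma gram_defect_dim [simp]:
  "dim_row (gram_defect d w N) = N" "dim_col (gram_defect d w N) = N"
  by (auto simp: carrier_matD[OF gram_defect_carrier])

lemma gram_defect_index:
  assumes "\<And>i. i \<in> {1..N} \<Longrightarrow> w i \<in> carrier_vec d" "i < N" "j < N"
  shows "gram_defect d w N $$ (i, j) = (if i < j then - (w (i + 1) \<bullet> w (j + 1)) else 0)"
  using assms by (simp add: gram_defect_def strict_upper_def col_col_mat)

text \<open>Unit length makes the diagonal of I - W^T W vanish, and a symmetric matrix with zero
  diagonal is the sum of its strict upper part and the transpose of that part.\<close>

lemma gram_eq:
  assumes "\<And>i. i \<in> {1..N} \<Longrightarrow> w i \<in> carrier_vec d \<and> vec_norm (w i) = 1"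
  shows "transpose_mat (col_mat d w N) * col_mat d w N
    = 1\<^sub>m N - (gram_defect d w N + transpose_mat (gram_defect d w N))"
proof (rule eq_matI)
  fix i j assume "i < dim_row (1\<^sub>m N - (gram_defect d w N + transpose_mat (gram_defect d w N)))"
    and "j < dim_col (1\<^sub>m N - (gram_defect d w N + transpose_mat (gram_defect d w N)))"
  then have ij: "i < N" "j < N" by auto
  have w: "w (i + 1) \<in> carrier_vec d" "w (j + 1) \<in> carrier_vec d"
    using assms ij by auto
  have S: "gram_defect d w N $$ (r, s) = (if r < s then - (w (r + 1) \<bullet> w (s + 1)) else 0)"
    if "r < N" "s < N" for r s
    by (rule gram_defect_index) (use assms that in auto)
  have "(vec_norm (w (i + 1)))\<^sup>2 = 1\<^sup>2"
    using assms ij by simp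
  then have "w (i + 1) \<bullet> w (i + 1) = 1"
    by (simp only: vec_norm_power2 power_one)
  moreover have "w (j + 1) \<bullet> w (i + 1) = w (i + 1) \<bullet> w (j + 1)"
    by (rule comm_scalar_prod[OF w(2,1)])
  ultimately show "(transpose_mat (col_mat d w N) * col_mat d w N) $$ (i, j)
      = (1\<^sub>m N - (gram_defect d w N + transpose_mat (gram_defect d w N))) $$ (i, j)"
    using ij w assms by (cases i j rule: linorder_cases) (simp_all add: S col_col_mat)
qed auto

text \<open>The Gram identity gives |W x|^2 = |x|^2 - 2 x.(S x), where the last term is at most
  |x|^2 / 2 in size when the level is at most 1/4. The squared ratio thus lies between 1/2 and 3/2,
  and the constant 2 leaves room on both sides.\<close>

lemma vec_norm_col_mat_bounds:
  assumes w: "\<And>i. i \<in> {1..N} \<Longrightarrow> w i \<in> carrier_vec d \<and> vec_norm (w i) = 1"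
    and lev: "orth_level d w N \<le> 1 / 4" and x: "x \<in> carrier_vec N"
  shows "vec_norm x \<le> 2 * vec_norm (col_mat d w N *\<^sub>v x)"
    and "vec_norm (col_mat d w N *\<^sub>v x) \<le> 2 * vec_norm x"
proof -
  let ?W = "col_mat d w N" and ?S = "gram_defect d w N"
  have Wx: "?W *\<^sub>v x \<in> carrier_vec d" and Sx: "?S *\<^sub>v x \<in> carrier_vec N"
    and Tx: "transpose_mat ?S *\<^sub>v x \<in> carrier_vec N"
    by (auto intro: carrier_vecI)
  have gram: "transpose_mat ?W * ?W = 1\<^sub>m N - (?S + transpose_mat ?S)"
    by (rule gram_eq) (rule w)
  have "(vec_norm (?W *\<^sub>v x))\<^sup>2 = (transpose_mat ?W *\<^sub>v (?W *\<^sub>v x)) \<bullet> x"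
    unfolding vec_norm_power2
    by (rule transpose_vec_mult_scalar[OF col_mat_carrier x Wx, symmetric])
  also have "transpose_mat ?W *\<^sub>v (?W *\<^sub>v x) = (transpose_mat ?W * ?W) *\<^sub>v x"
    using assoc_mult_mat_vec[of "transpose_mat ?W" N d ?W N x] x by simp
  also have "\<dots> = x - (?S *\<^sub>v x + transpose_mat ?S *\<^sub>v x)"
    using x by (simp add: gram minus_mult_distrib_mat_vec[of _ N N] add_mult_distrib_mat_vec[of _ N N])
  also have "\<dots> \<bullet> x = x \<bullet> x - ((?S *\<^sub>v x) \<bullet> x + (transpose_mat ?S *\<^sub>v x) \<bullet> x)"
    using x Sx Tx by (simp add: minus_scalar_prod_distrib[of _ N] add_scalar_prod_distrib[of _ N])
  also have "(transpose_mat ?S *\<^sub>v x) \<bullet> x = x \<bullet> (?S *\<^sub>v x)"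
    by (rule transpose_vec_mult_scalar[OF gram_defect_carrier x x])
  also have "(?S *\<^sub>v x) \<bullet> x = x \<bullet> (?S *\<^sub>v x)"
    by (rule comm_scalar_prod[OF Sx x])
  finally have eq: "(vec_norm (?W *\<^sub>v x))\<^sup>2 = (vec_norm x)\<^sup>2 - 2 * (x \<bullet> (?S *\<^sub>v x))"
    by (simp add: vec_norm_power2)
  have "\<bar>x \<bullet> (?S *\<^sub>v x)\<bar> \<le> vec_norm x * vec_norm (?S *\<^sub>v x)"
    using scalar_prod_abs_le[of x "?S *\<^sub>v x"] x by simp
  also have "\<dots> \<le> vec_norm x * (1 / 4 * vec_norm x)"
  proof (intro mult_left_mono)
    have "vec_norm (?S *\<^sub>v x) \<le> mat_norm ?S * vec_norm x"
      using x by (intro vec_norm_mult_le) simp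
    also have "\<dots> \<le> 1 / 4 * vec_norm x"
      using lev by (intro mult_right_mono) (auto simp: orth_level_def gram_defect_def)
    finally show "vec_norm (?S *\<^sub>v x) \<le> 1 / 4 * vec_norm x" .
  qed simp
  finally have "\<bar>x \<bullet> (?S *\<^sub>v x)\<bar> \<le> (vec_norm x)\<^sup>2 / 4"
    by (simp add: power2_eq_square)
  then have "(vec_norm x)\<^sup>2 \<le> (2 * vec_norm (?W *\<^sub>v x))\<^sup>2"
    and "(vec_norm (?W *\<^sub>v x))\<^sup>2 \<le> (2 * vec_norm x)\<^sup>2"
    using eq zero_le_power2[of "vec_norm x"] by (auto simp: power_mult_distrib)
  then show "vec_norm x \<le> 2 * vec_norm (?W *\<^sub>v x)" "vec_norm (?W *\<^sub>v x) \<le> 2 * vec_norm x"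
    by (auto intro: power2_le_imp_le simp del: power_mult_distrib)
qed

section \<open>The products of reflections\<close>

lemma P_mat_carrier [simp]: "P_mat m n u i \<in> carrier_mat (m + n + 1) (m + n + 1)"
  by (auto simp: P_mat_def)

lemma P_hat_carrier [simp]: "P_hat m n u i \<in> carrier_mat (m + n + 1) (m + n + 1)"
  by (induction i) (auto intro!: mult_carrier_mat[OF _ P_mat_carrier, simplified])

lemma P_mat_mult_vec:
  assumes "u i \<in> carrier_vec m" "y \<in> carrier_vec (m + n + 1)"
  shows "P_mat m n u i *\<^sub>v y = y - (p_vec n u i \<bullet> y) \<cdot>\<^sub>v p_vec n u i"
proof -
  let ?p = "p_vec n u i" and ?M = "mat_of_cols (m + n + 1) [p_vec n u i]"
  have p: "?p \<in> carrier_vec (m + n + 1)"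
    using assms(1) by (intro carrier_vecI) (simp add: p_vec_def)
  have "(?M * transpose_mat ?M) *\<^sub>v y = ?M *\<^sub>v (transpose_mat ?M *\<^sub>v y)"
    using assms(2) by (intro assoc_mult_mat_vec[of _ "m + n + 1" 1 _ "m + n + 1"]) auto
  also have "\<dots> = (?p \<bullet> y) \<cdot>\<^sub>v ?p"
    using p by (intro eq_vecI) (auto simp: scalar_prod_def mat_of_cols_index)
  finally show ?thesis
    unfolding P_mat_def using assms(2)
    by (subst minus_mult_distrib_mat_vec[of _ "m + n + 1" "m + n + 1"]) (auto intro!: mult_carrier_mat)
qed

lemma p_vec_scalar_prod_append:
  assumes "u (Suc i) \<in> carrier_vec m" "a \<in> carrier_vec (n + 1)" "b \<in> carrier_vec m" "i \<le> n"
  shows "p_vec n u (Suc i) \<bullet> (a @\<^sub>v b) = u (Suc i) \<bullet> b - a $ i"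
  using assms by (simp add: p_vec_def scalar_prod_append[of _ "n + 1" _ m])

text \<open>The scalar product of \<open>p_vec\<close> with the stacked vector is t = u.b - a_i, so
  the factor removes t times u from the lower block and records t in entry i of the upper
  one.\<close>

lemma P_mat_append:
  assumes "u (Suc i) \<in> carrier_vec m" "a \<in> carrier_vec (n + 1)" "b \<in> carrier_vec m" "i \<le> n"
  shows "P_mat m n u (Suc i) *\<^sub>v (a @\<^sub>v b) =
    (a + (u (Suc i) \<bullet> b - a $ i) \<cdot>\<^sub>v unit_vec (n + 1) i)
      @\<^sub>v (b - (u (Suc i) \<bullet> b - a $ i) \<cdot>\<^sub>v u (Suc i))"
proof -
  have "a @\<^sub>v b \<in> carrier_vec (m + n + 1)"
    using append_carrier_vec[OF assms(2,3)] by (simp add: ac_simps)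
  then have "P_mat m n u (Suc i) *\<^sub>v (a @\<^sub>v b)
      = (a @\<^sub>v b) - (u (Suc i) \<bullet> b - a $ i) \<cdot>\<^sub>v p_vec n u (Suc i)"
    using P_mat_mult_vec[of u "Suc i" m "a @\<^sub>v b" n] p_vec_scalar_prod_append[of u i m a n b] assms
    by simp
  then show ?thesis
    using assms by (intro eq_vecI) (auto simp: p_vec_def algebra_simps)
qed

text \<open>Applying \<open>P\<^sub>j, \<dots>, P\<^sub>1\<close> in turn is modified Gram-Schmidt: the lower block is
  orthogonalized against \<open>u\<^sub>j, \<dots>, u\<^sub>1\<close> and the upper block collects the coefficients.\<close>

lemma P_hat_append:
  assumes "\<And>i. i \<in> {1..j} \<Longrightarrow> u i \<in> carrier_vec m" "j \<le> n + 1"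
    and "a \<in> carrier_vec (n + 1)" "b \<in> carrier_vec m"
  shows "\<exists>c. P_hat m n u j *\<^sub>v (a @\<^sub>v b) =
        vec (n + 1) (\<lambda>l. a $ l + (if l < j then c l else 0))
          @\<^sub>v vec m (\<lambda>r. b $ r - (\<Sum>l<j. c l * u (l + 1) $ r)) \<and>
      (\<forall>l<j. c l = u (l + 1) \<bullet> b - (\<Sum>r\<in>{l<..<j}. c r * (u (l + 1) \<bullet> u (r + 1))) - a $ l)"
  using assms
proof (induction j arbitrary: a b)
  case 0
  have "a @\<^sub>v b \<in> carrier_vec (m + n + 1)"
    using append_carrier_vec[OF 0(3,4)] by (simp add: ac_simps)
  moreover have "vec (n + 1) (\<lambda>l. a $ l) = a" "vec m (\<lambda>r. b $ r) = b"
    using 0 by auto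
  ultimately show ?case by simp
next
  case (Suc j)
  let ?u = "u (Suc j)"
  \<comment> \<open>The last factor of the product acts first: \<open>t\<close> is the coefficient
    it removes, and \<open>a'\<close> and \<open>b'\<close> are the two blocks after it.\<close>
  define t where "t = ?u \<bullet> b - a $ j"
  define a' where "a' = a + t \<cdot>\<^sub>v unit_vec (n + 1) j"
  define b' where "b' = b - t \<cdot>\<^sub>v ?u"
  have u: "?u \<in> carrier_vec m" and j: "j \<le> n"
    using Suc.prems by auto
  have a': "a' \<in> carrier_vec (n + 1)" and b': "b' \<in> carrier_vec m"
    using Suc.prems u by (auto simp: a'_def b'_def)
  have ab: "a @\<^sub>v b \<in> carrier_vec (m + n + 1)"
    using append_carrier_vec[OF Suc.prems(3,4)] by (simp add: ac_simps)
  have step: "P_hat m n u (Suc j) *\<^sub>v (a @\<^sub>v b) = P_hat m n u j *\<^sub>v (a' @\<^sub>v b')"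
    using assoc_mult_mat_vec[OF P_hat_carrier P_mat_carrier ab]
      P_mat_append[of u, OF u Suc.prems(3,4) j]
    by (simp add: a'_def b'_def t_def)
  have "\<exists>c. P_hat m n u j *\<^sub>v (a' @\<^sub>v b') =
        vec (n + 1) (\<lambda>l. a' $ l + (if l < j then c l else 0))
          @\<^sub>v vec m (\<lambda>r. b' $ r - (\<Sum>l<j. c l * u (l + 1) $ r)) \<and>
      (\<forall>l<j. c l = u (l + 1) \<bullet> b' - (\<Sum>r\<in>{l<..<j}. c r * (u (l + 1) \<bullet> u (r + 1))) - a' $ l)"
    using Suc.prems a' b' by (intro Suc.IH) auto
  then obtain c where c: "P_hat m n u j *\<^sub>v (a' @\<^sub>v b') =
        vec (n + 1) (\<lambda>l. a' $ l + (if l < j then c l else 0))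
          @\<^sub>v vec m (\<lambda>r. b' $ r - (\<Sum>l<j. c l * u (l + 1) $ r))"
    and rec: "\<And>l. l < j \<Longrightarrow>
      c l = u (l + 1) \<bullet> b' - (\<Sum>r\<in>{l<..<j}. c r * (u (l + 1) \<bullet> u (r + 1))) - a' $ l"
    by blast
  show ?case
  \<comment> \<open>The induction hypothesis for the updated blocks supplies the coefficients below
    \<open>j\<close>; the new one is \<open>t\<close>.\<close>
  proof (intro exI[of _ "c(j := t)"] conjI allI impI)
    have "vec (n + 1) (\<lambda>l. a' $ l + (if l < j then c l else 0))
        = vec (n + 1) (\<lambda>l. a $ l + (if l < Suc j then (c(j := t)) l else 0))"
      using Suc.prems j by (intro eq_vecI) (auto simp: a'_def)
    moreover have "vec m (\<lambda>r. b' $ r - (\<Sum>l<j. c l * u (l + 1) $ r))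
        = vec m (\<lambda>r. b $ r - (\<Sum>l<Suc j. (c(j := t)) l * u (l + 1) $ r))"
      using Suc.prems(4) carrier_vecD[OF u] by (intro eq_vecI) (auto simp: b'_def)
    ultimately show "P_hat m n u (Suc j) *\<^sub>v (a @\<^sub>v b) =
        vec (n + 1) (\<lambda>l. a $ l + (if l < Suc j then (c(j := t)) l else 0))
          @\<^sub>v vec m (\<lambda>r. b $ r - (\<Sum>l<Suc j. (c(j := t)) l * u (l + 1) $ r))"
      by (simp only: step c)
  next
    fix l assume l: "l < Suc j"
    show "(c(j := t)) l = u (l + 1) \<bullet> b
      - (\<Sum>r\<in>{l<..<Suc j}. (c(j := t)) r * (u (l + 1) \<bullet> u (r + 1))) - a $ l"
    proof (cases "l = j")
      case True
      moreover have "{j<..<Suc j} = {}" by auto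
      ultimately show ?thesis by (simp add: t_def)
    next
      case False
      then have lj: "l < j" using l by simp
      have ul: "u (l + 1) \<in> carrier_vec m" using Suc.prems(1) lj by simp
      \<comment> \<open>The extra summand \<open>r = j\<close> is exactly the difference between the
        scalar products with \<open>b\<close> and with \<open>b'\<close>.\<close>
      have "{l<..<Suc j} = insert j {l<..<j}" using lj by auto
      moreover have "u (l + 1) \<bullet> b' = u (l + 1) \<bullet> b - t * (u (l + 1) \<bullet> ?u)"
        using Suc.prems(4) u ul by (simp add: b'_def scalar_prod_minus_distrib[of _ m])
      moreover have "a' $ l = a $ l"
        using Suc.prems(3) lj j by (simp add: a'_def)
      ultimately show ?thesis
        using rec[OF lj] lj by simp
    qed
  qed
qed

text \<open>With a zero lower block the Gram-Schmidt recursion says that c_l is minus the sum of c_r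
  (u_l . u_r) over r > l, minus B_l. In matrix form this is \<open>S c = B + c\<close>, that is, c =
  -(I - S)^(-1) B without any inverse being formed.\<close>

lemma P_hat_append_rows:
  assumes u: "\<And>i. i \<in> {1..k + 1} \<Longrightarrow> u i \<in> carrier_vec m" and k: "k \<le> n"
    and B: "B \<in> carrier_mat (k + 1) q"
  shows "\<exists>c \<in> carrier_mat (k + 1) q. gram_defect m u (k + 1) * c = B + c \<and>
    P_hat m n u (k + 1) * (B @\<^sub>r 0\<^sub>m (m + n - k) q)
      = (B + c) @\<^sub>r (0\<^sub>m (n - k) q @\<^sub>r - (col_mat m u (k + 1) * c))"
proof -
  \<comment> \<open>Columns are split after n + 1 entries, as the vectors \<open>p_vec\<close> are,
    and not after the k + 1 rows of \<open>B\<close>; hence the padding by zeros.\<close>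
  let ?a = "\<lambda>j. vec (n + 1) (\<lambda>l. if l < k + 1 then B $$ (l, j) else 0)"
  let ?Q = "\<lambda>j c. P_hat m n u (k + 1) *\<^sub>v (?a j @\<^sub>v 0\<^sub>v m) =
        vec (n + 1) (\<lambda>l. ?a j $ l + (if l < k + 1 then c l else 0))
          @\<^sub>v vec m (\<lambda>r. 0\<^sub>v m $ r - (\<Sum>l<k + 1. c l * u (l + 1) $ r)) \<and>
      (\<forall>l<k + 1. c l = u (l + 1) \<bullet> 0\<^sub>v m
        - (\<Sum>r\<in>{l<..<k + 1}. c r * (u (l + 1) \<bullet> u (r + 1))) - ?a j $ l)"
  have "\<forall>j. \<exists>c. ?Q j c"
    using u k by (intro allI P_hat_append) auto
  then obtain c where c: "\<And>j. ?Q j (c j)"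
    unfolding choice_iff by blast
  define C where "C = mat (k + 1) q (\<lambda>(l, j). c j l)"
  have C: "C \<in> carrier_mat (k + 1) q" by (simp add: C_def)
  have BR: "B @\<^sub>r 0\<^sub>m (m + n - k) q \<in> carrier_mat (m + n + 1) q"
    using carrier_append_rows[OF B, of "0\<^sub>m (m + n - k) q" "m + n - k"] k by simp
  have UC: "- (col_mat m u (k + 1) * C) \<in> carrier_mat m q"
    using C by auto
  have R: "0\<^sub>m (n - k) q @\<^sub>r - (col_mat m u (k + 1) * C) \<in> carrier_mat (n - k + m) q"
    using UC by auto
  have BC: "B + C \<in> carrier_mat (k + 1) q" using B C by auto
  have SC: "gram_defect m u (k + 1) * C = B + C"
  proof (rule eq_matI)
    fix l j assume "l < dim_row (B + C)" "j < dim_col (B + C)"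
    then have lj: "l < k + 1" "j < q" using C by auto
    have S: "gram_defect m u (k + 1) $$ (l, r) = (if l < r then - (u (l + 1) \<bullet> u (r + 1)) else 0)"
      if "r < k + 1" for r
      by (rule gram_defect_index) (use u that lj in auto)
    have "(gram_defect m u (k + 1) * C) $$ (l, j)
        = (\<Sum>r<k + 1. gram_defect m u (k + 1) $$ (l, r) * c j r)"
      using lj C by (simp add: scalar_prod_def C_def lessThan_atLeast0)
    \<comment> \<open>The defect matrix is strictly upper triangular, so only \<open>r > l\<close>
      survives.\<close>
    also have "\<dots> = (\<Sum>r\<in>{l<..<k + 1}. - (c j r * (u (l + 1) \<bullet> u (r + 1))))"
      using lj by (intro sum.mono_neutral_cong_right)
        (auto simp: S[simplified])
    also have "\<dots> = (B + C) $$ (l, j)"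
      using c[of j] lj k B C u[of "l + 1"] by (simp add: C_def sum_negf)
    finally show "(gram_defect m u (k + 1) * C) $$ (l, j) = (B + C) $$ (l, j)" .
  qed (use C in auto)
  have "P_hat m n u (k + 1) * (B @\<^sub>r 0\<^sub>m (m + n - k) q)
      = (B + C) @\<^sub>r (0\<^sub>m (n - k) q @\<^sub>r - (col_mat m u (k + 1) * C))"
  proof (rule eq_matI)
    fix i j
    assume "i < dim_row ((B + C) @\<^sub>r (0\<^sub>m (n - k) q @\<^sub>r - (col_mat m u (k + 1) * C)))"
      and "j < dim_col ((B + C) @\<^sub>r (0\<^sub>m (n - k) q @\<^sub>r - (col_mat m u (k + 1) * C)))"
    then have ij: "i < m + n + 1" "j < q"
      using carrier_append_rows[OF BC R] k by auto
    have "col (B @\<^sub>r 0\<^sub>m (m + n - k) q) j = ?a j @\<^sub>v 0\<^sub>v m"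
      using carrier_matD[OF BR] ij k
      by (intro eq_vecI) (auto simp: append_rows_index[OF B zero_carrier_mat, simplified])
    then have "(P_hat m n u (k + 1) * (B @\<^sub>r 0\<^sub>m (m + n - k) q)) $$ (i, j)
        = (P_hat m n u (k + 1) *\<^sub>v (?a j @\<^sub>v 0\<^sub>v m)) $ i"
      using ij BR carrier_matD[OF P_hat_carrier[of m n u "k + 1"]] by simp
    also have "\<dots> = ((B + C) @\<^sub>r (0\<^sub>m (n - k) q @\<^sub>r - (col_mat m u (k + 1) * C))) $$ (i, j)"
    proof -
      have U: "(col_mat m u (k + 1) * C) $$ (r, j) = (\<Sum>l<k + 1. c j l * u (l + 1) $ r)"
        if "r < m" for r
        using that ij C by (simp add: scalar_prod_def lessThan_atLeast0 C_def mult.commute)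
      have "((B + C) @\<^sub>r (0\<^sub>m (n - k) q @\<^sub>r - (col_mat m u (k + 1) * C))) $$ (i, j)
          = (if i < k + 1 then B $$ (i, j) + C $$ (i, j) else if i < n + 1 then 0
             else - (col_mat m u (k + 1) * C) $$ (i - (n + 1), j))"
        using append_rows3_index[OF BC zero_carrier_mat UC, of i "n - k" j] ij k B C
        by (auto simp del: index_mult_mat(1))
      moreover have "C $$ (i, j) = c j i" if "i < k + 1"
        using that ij by (simp add: C_def)
      ultimately show ?thesis
        using ij k U[of "i - (n + 1)"]
        by (subst conjunct1[OF c]) auto
    qed
    finally show "(P_hat m n u (k + 1) * (B @\<^sub>r 0\<^sub>m (m + n - k) q)) $$ (i, j) =
        ((B + C) @\<^sub>r (0\<^sub>m (n - k) q @\<^sub>r - (col_mat m u (k + 1) * C))) $$ (i, j)" .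
  qed (use carrier_append_rows[OF BC R] BR k carrier_matD[OF P_hat_carrier[of m n u "k + 1"]] in auto)
  with SC C show ?thesis by blast
qed

text \<open>A vector orthogonal to \<open>p_vec n u l\<close> is fixed by
  \<open>P_mat m n u l\<close>, so the trailing factors drop out. This reconciles the products in
  \<open>x_vec\<close>, which grow with the column, with the single product in the
  factorization.\<close>

lemma P_hat_mult_vec_eq:
  assumes "\<And>l. l \<in> {i<..j} \<Longrightarrow> u l \<in> carrier_vec m \<and> p_vec n u l \<bullet> y = 0"
    and y: "y \<in> carrier_vec (m + n + 1)" and "i \<le> j"
  shows "P_hat m n u j *\<^sub>v y = P_hat m n u i *\<^sub>v y"
  using \<open>i \<le> j\<close> assms(1)
proof (induction j rule: dec_induct)
  case (step j)
  have p: "u (Suc j) \<in> carrier_vec m" "p_vec n u (Suc j) \<bullet> y = 0"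
    using step by auto
  have "P_mat m n u (Suc j) *\<^sub>v y = y"
    unfolding P_mat_mult_vec[of u, OF p(1) y] p(2)
    using y p(1) by (intro eq_vecI) (auto simp: p_vec_def)
  then have "P_hat m n u (Suc j) *\<^sub>v y = P_hat m n u j *\<^sub>v y"
    using assoc_mult_mat_vec[OF P_hat_carrier P_mat_carrier y] by simp
  also have "\<dots> = P_hat m n u i *\<^sub>v y"
    using step by auto
  finally show ?case .
qed simp

section \<open>The exact factorization of the perturbed matrix\<close>

lemma X_mat_carrier [simp]: "X_mat m n A u v \<alpha> \<beta> k \<in> carrier_mat (m + n + 1) k"
  unfolding X_mat_def by (rule col_mat_carrier)

lemma bidiag_carrier [simp]: "bidiag \<alpha> \<beta> k \<in> carrier_mat (k + 1) k"
  by (simp add: bidiag_def)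

text \<open>Column by column this is the definition of \<open>x_vec\<close>, once its shorter
  product is replaced by the full one and its vector is recognized as a column of the stacked
  bidiagonal matrix.\<close>

lemma X_mat_identity:
  assumes A: "A \<in> carrier_mat m n" and u: "\<And>i. i \<in> {1..k + 1} \<Longrightarrow> u i \<in> carrier_vec m"
    and v: "\<And>i. i \<in> {1..k} \<Longrightarrow> v i \<in> carrier_vec n" and k: "k \<le> n"
  shows "(0\<^sub>m (n + 1) k @\<^sub>r (A * col_mat n v k)) + X_mat m n A u v \<alpha> \<beta> k
      = P_hat m n u (k + 1) * (bidiag \<alpha> \<beta> k @\<^sub>r 0\<^sub>m (m + n - k) k)" (is "?L = ?R")
proof (rule eq_matI)
  have AV: "A * col_mat n v k \<in> carrier_mat m k"
    using A by auto
  have BR: "bidiag \<alpha> \<beta> k @\<^sub>r 0\<^sub>m (m + n - k) k \<in> carrier_mat (m + n + 1) k"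
    using carrier_append_rows[OF bidiag_carrier zero_carrier_mat, of \<alpha> \<beta> k "m + n - k"] k by simp
  have R: "?R \<in> carrier_mat (m + n + 1) k"
    by (rule mult_carrier_mat[OF P_hat_carrier BR])
  fix i j assume "i < dim_row ?R" "j < dim_col ?R"
  then have ij: "i < m + n + 1" "j < k"
    using carrier_matD[OF R] by auto
  define y where "y = (\<alpha> (j + 1) \<cdot>\<^sub>v unit_vec (j + 1) (j + 1 - 1))
    @\<^sub>v (\<beta> (j + 1 + 1) \<cdot>\<^sub>v unit_vec (m + n - (j + 1) + 1) 0)"
  \<comment> \<open>The upper block of \<open>y\<close> when its split is moved to the n + 1 entries
    of \<open>p_vec\<close>: the nonzero entries sit at positions j and j + 1, and j + 1 <= k <=
    n.\<close>
  define a where "a = \<alpha> (j + 1) \<cdot>\<^sub>v unit_vec (n + 1) j + \<beta> (j + 2) \<cdot>\<^sub>v unit_vec (n + 1) (j + 1)"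
  have a: "a \<in> carrier_vec (n + 1)" by (simp add: a_def)
  have y_a: "y = a @\<^sub>v 0\<^sub>v m"
    using ij k by (intro eq_vecI) (auto simp: y_def a_def)
  have y: "y \<in> carrier_vec (m + n + 1)"
    using append_carrier_vec[OF a zero_carrier_vec[of m]] by (simp add: y_a ac_simps)
  \<comment> \<open>The unit entry of \<open>p_vec n u l\<close> is at position l - 1 > j + 1,
    outside the support of \<open>a\<close>, and the lower block of \<open>y\<close> is
    zero.\<close>
  have "p_vec n u l \<bullet> y = 0" if l: "l \<in> {j + 2<..k + 1}" for l
  proof -
    obtain l' where l': "l = Suc l'" "j + 1 < l'" "l' \<le> n"
      using l k by (cases l) auto
    then show ?thesis
      using p_vec_scalar_prod_append[of u l' m a n "0\<^sub>v m"] u[of l] l a ij k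
      by (simp add: y_a) (simp add: a_def)
  qed
  then have Py: "P_hat m n u (k + 1) *\<^sub>v y = P_hat m n u (j + 2) *\<^sub>v y"
    using u ij y by (intro P_hat_mult_vec_eq) auto
  have B_col: "col (bidiag \<alpha> \<beta> k @\<^sub>r 0\<^sub>m (m + n - k) k) j = y"
  proof (rule eq_vecI)
    fix l assume "l < dim_vec y"
    then have l: "l < m + n + 1" using carrier_vecD[OF y] by simp
    have "(bidiag \<alpha> \<beta> k @\<^sub>r 0\<^sub>m (m + n - k) k) $$ (l, j)
        = (if l < k + 1 then bidiag \<alpha> \<beta> k $$ (l, j) else 0\<^sub>m (m + n - k) k $$ (l - (k + 1), j))"
      using l ij k by (intro append_rows_index[OF bidiag_carrier zero_carrier_mat]) auto
    then show "col (bidiag \<alpha> \<beta> k @\<^sub>r 0\<^sub>m (m + n - k) k) j $ l = y $ l"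
      using l ij k carrier_matD[OF BR] by (auto simp: y_a a_def bidiag_def)
  qed (use carrier_matD[OF BR] carrier_vecD[OF y] in auto)
  have "?R $$ (i, j) = (P_hat m n u (k + 1) *\<^sub>v y) $ i"
    using ij carrier_matD[OF BR] carrier_matD[OF P_hat_carrier[of m n u]]
    by (simp add: B_col del: P_hat.simps)
  then have R_eq: "?R $$ (i, j) = (P_hat m n u (j + 2) *\<^sub>v y) $ i"
    unfolding Py .
  have "(0\<^sub>m (n + 1) k @\<^sub>r (A * col_mat n v k)) $$ (i, j) = (0\<^sub>v (n + 1) @\<^sub>v (A *\<^sub>v v (j + 1))) $ i"
  proof -
    have "col (col_mat n v k) j = v (j + 1)"
      using v ij by (intro col_col_mat) auto
    then show ?thesis
      using append_rows_index[OF zero_carrier_mat AV, of i "n + 1" j] ij A by auto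
  qed
  moreover have "X_mat m n A u v \<alpha> \<beta> k $$ (i, j) = (P_hat m n u (j + 2) *\<^sub>v y) $ i
      - (0\<^sub>v (n + 1) @\<^sub>v (A *\<^sub>v v (j + 1))) $ i"
    using ij A carrier_matD[OF P_hat_carrier[of m n u]]
    by (simp add: X_mat_def x_vec_def y_def)
  ultimately show "?L $$ (i, j) = ?R $$ (i, j)"
    using R_eq ij carrier_matD[OF X_mat_carrier[of m n A u v \<alpha> \<beta> k]]
    by simp
qed (use carrier_matD[OF X_mat_carrier[of m n A u v \<alpha> \<beta> k]]
  carrier_matD[OF P_hat_carrier[of m n u "k + 1"]] in \<open>auto simp: append_rows_def bidiag_def\<close>)

section \<open>The recurrences in matrix form\<close>

text \<open>The last row is zero; it gives the matrix the shape of \<open>bidiag\<close>, so that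
  the two can be added.\<close>

definition xi_mat :: "(nat \<Rightarrow> nat \<Rightarrow> real) \<Rightarrow> nat \<Rightarrow> real mat" where
  "xi_mat \<xi> k = mat (k + 1) k (\<lambda>(j, i). if j \<le> i then \<xi> (j + 1) (i + 1) else 0)"

text \<open>The conditions overlap: on the superdiagonal the recurrence coefficient
  \<open>\<beta>\<close> and a reorthogonalization coefficient \<open>\<eta>\<close> add up. The
  first column carries no \<open>\<beta>\<close>, since \<open>v 0\<close> is the zero
  vector.\<close>

definition eta_mat ::
  "(nat \<Rightarrow> real) \<Rightarrow> (nat \<Rightarrow> real) \<Rightarrow> (nat \<Rightarrow> nat \<Rightarrow> real) \<Rightarrow> nat \<Rightarrow> real mat" where
  "eta_mat \<alpha> \<beta> \<eta> k = mat k k (\<lambda>(l, j). (if l = j then \<alpha> (j + 1) else 0)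
     + (if l + 1 = j then \<beta> (j + 1) else 0) + (if l < j then \<eta> (l + 1) (j + 1) else 0))"

lemma xi_mat_carrier [simp]: "xi_mat \<xi> k \<in> carrier_mat (k + 1) k"
  by (simp add: xi_mat_def)

lemma eta_mat_carrier [simp]: "eta_mat \<alpha> \<beta> \<eta> k \<in> carrier_mat k k"
  by (simp add: eta_mat_def)

lemma lbro_mult_A:
  assumes "lbro m n k A u v \<alpha> \<beta> \<xi> \<eta> f g"
  shows "A * col_mat n v k
    = col_mat m u (k + 1) * (bidiag \<alpha> \<beta> k + xi_mat \<xi> k) + col_mat m f k" (is "_ = ?R")
proof (rule eq_matI)
  have A: "A \<in> carrier_mat m n" using assms by (simp add: lbro_def)
  fix r i assume "r < dim_row ?R" "i < dim_col ?R"
  then have ri: "r < m" "i < k" by auto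
  have u: "u j \<in> carrier_vec m" if "j \<in> {1..k + 1}" for j
    using assms that by (simp add: lbro_def)
  have v: "v (i + 1) \<in> carrier_vec n" and f: "f (i + 1) \<in> carrier_vec m"
    using assms ri by (simp_all add: lbro_def)
  have "A *\<^sub>v v (i + 1) = \<alpha> (i + 1) \<cdot>\<^sub>v u (i + 1) + \<beta> (i + 1 + 1) \<cdot>\<^sub>v u (i + 1 + 1)
      + finsum_vec TYPE(real) m (\<lambda>j. \<xi> j (i + 1) \<cdot>\<^sub>v u j) {1..i + 1} + f (i + 1)"
  proof -
    have "\<forall>i\<in>{1..k}. A *\<^sub>v v i = \<alpha> i \<cdot>\<^sub>v u i + \<beta> (i + 1) \<cdot>\<^sub>v u (i + 1)
        + finsum_vec TYPE(real) m (\<lambda>j. \<xi> j i \<cdot>\<^sub>v u j) {1..i} + f i"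
      using assms unfolding lbro_def by blast
    then show ?thesis by (rule bspec) (use ri in simp)
  qed
  moreover have "finsum_vec TYPE(real) m (\<lambda>j. \<xi> j (i + 1) \<cdot>\<^sub>v u j) {1..i + 1} $ r
      = (\<Sum>j\<in>{1..i + 1}. (\<xi> j (i + 1) \<cdot>\<^sub>v u j) $ r)"
    using u ri by (intro index_finsum_vec) auto
  moreover have "\<dots> = (\<Sum>j<i + 1. u (j + 1) $ r * \<xi> (j + 1) (i + 1))"
  proof -
    have "(\<Sum>j\<in>{1..i + 1}. (\<xi> j (i + 1) \<cdot>\<^sub>v u j) $ r)
        = (\<Sum>j\<in>{1..i + 1}. u j $ r * \<xi> j (i + 1))"
      using carrier_vecD[OF u] ri by (intro sum.cong) auto
    also have "\<dots> = (\<Sum>j<i + 1. u (j + 1) $ r * \<xi> (j + 1) (i + 1))"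
      by (simp add: sum.atLeast1_atMost_eq)
    finally show ?thesis .
  qed
  moreover have "finsum_vec TYPE(real) m (\<lambda>j. \<xi> j (i + 1) \<cdot>\<^sub>v u j) {1..i + 1} \<in> carrier_vec m"
    using u ri by (intro finsum_vec_closed) auto
  ultimately have L: "(A *\<^sub>v v (i + 1)) $ r = \<alpha> (i + 1) * u (i + 1) $ r + \<beta> (i + 2) * u (i + 2) $ r
      + (\<Sum>j<i + 1. u (j + 1) $ r * \<xi> (j + 1) (i + 1)) + f (i + 1) $ r"
    using carrier_vecD[OF u[of "i + 1"]] carrier_vecD[OF u[of "i + 2"]] carrier_vecD[OF f] ri
    by (auto simp del: sum.lessThan_Suc)
  have "(col_mat m u (k + 1) * (bidiag \<alpha> \<beta> k + xi_mat \<xi> k)) $$ (r, i)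
      = (\<Sum>l<k + 1. u (l + 1) $ r * (bidiag \<alpha> \<beta> k + xi_mat \<xi> k) $$ (l, i))"
    using ri carrier_matD[OF xi_mat_carrier] by (simp add: scalar_prod_def lessThan_atLeast0)
  \<comment> \<open>Diagonal, subdiagonal and reorthogonalization parts are separated, so that the
    first two sums collapse and the third is truncated.\<close>
  also have "\<dots> = (\<Sum>l<k + 1. (if l = i then u (l + 1) $ r * \<alpha> (i + 1) else 0)
      + (if l = i + 1 then u (l + 1) $ r * \<beta> (i + 2) else 0)
      + (if l < i + 1 then u (l + 1) $ r * \<xi> (l + 1) (i + 1) else 0))"
    using ri by (intro sum.cong) (auto simp: bidiag_def xi_mat_def distrib_left)
  also have "\<dots> = u (i + 1) $ r * \<alpha> (i + 1) + u (i + 2) $ r * \<beta> (i + 2)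
      + (\<Sum>l<k + 1. if l < i + 1 then u (l + 1) $ r * \<xi> (l + 1) (i + 1) else 0)"
    using ri by (simp add: sum.distrib del: sum.lessThan_Suc)
  also have "(\<Sum>l<k + 1. if l < i + 1 then u (l + 1) $ r * \<xi> (l + 1) (i + 1) else 0)
      = (\<Sum>l<i + 1. u (l + 1) $ r * \<xi> (l + 1) (i + 1))"
    using ri by (intro sum.mono_neutral_cong_right) auto
  finally have R: "(col_mat m u (k + 1) * (bidiag \<alpha> \<beta> k + xi_mat \<xi> k)) $$ (r, i)
      = u (i + 1) $ r * \<alpha> (i + 1) + u (i + 2) $ r * \<beta> (i + 2)
      + (\<Sum>l<i + 1. u (l + 1) $ r * \<xi> (l + 1) (i + 1))" .
  have "(A * col_mat n v k) $$ (r, i) = (A *\<^sub>v v (i + 1)) $ r"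
    using A ri col_col_mat[of i k v n] v by simp
  also have "\<dots> = (col_mat m u (k + 1) * (bidiag \<alpha> \<beta> k + xi_mat \<xi> k)) $$ (r, i) + f (i + 1) $ r"
    unfolding L R by (simp add: mult.commute del: sum.lessThan_Suc)
  also have "\<dots> = ?R $$ (r, i)"
    using ri by (simp del: index_mult_mat(1))
  finally show "(A * col_mat n v k) $$ (r, i) = ?R $$ (r, i)" .
qed (use assms in \<open>auto simp: lbro_def\<close>)

lemma lbro_mult_At:
  assumes "lbro m n k A u v \<alpha> \<beta> \<xi> \<eta> f g"
  shows "transpose_mat A * col_mat m u k
    = col_mat n v k * eta_mat \<alpha> \<beta> \<eta> k + col_mat n g k" (is "_ = ?R")
proof (rule eq_matI)
  have A: "A \<in> carrier_mat m n" using assms by (simp add: lbro_def)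
  fix r i assume "r < dim_row ?R" "i < dim_col ?R"
  then have ri: "r < n" "i < k" by auto
  have v0: "v 0 = 0\<^sub>v n"
    using assms by (simp add: lbro_def)
  have v: "v j \<in> carrier_vec n" if "j \<le> k" for j
    using assms that by (cases "j = 0") (simp_all add: lbro_def)
  have u: "u (i + 1) \<in> carrier_vec m" and g: "g (i + 1) \<in> carrier_vec n"
    using assms ri by (simp_all add: lbro_def)
  have "transpose_mat A *\<^sub>v u (i + 1) = \<alpha> (i + 1) \<cdot>\<^sub>v v (i + 1) + \<beta> (i + 1) \<cdot>\<^sub>v v (i + 1 - 1)
      + finsum_vec TYPE(real) n (\<lambda>j. \<eta> j (i + 1) \<cdot>\<^sub>v v j) {1..i + 1 - 1} + g (i + 1)"
  proof -
    have "\<forall>i\<in>{1..k + 1}. transpose_mat A *\<^sub>v u i = \<alpha> i \<cdot>\<^sub>v v i + \<beta> i \<cdot>\<^sub>v v (i - 1)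
        + finsum_vec TYPE(real) n (\<lambda>j. \<eta> j i \<cdot>\<^sub>v v j) {1..i - 1} + g i"
      using assms unfolding lbro_def by blast
    then show ?thesis by (rule bspec) (use ri in simp)
  qed
  moreover have "finsum_vec TYPE(real) n (\<lambda>j. \<eta> j (i + 1) \<cdot>\<^sub>v v j) {1..i} $ r
      = (\<Sum>j\<in>{1..i}. (\<eta> j (i + 1) \<cdot>\<^sub>v v j) $ r)"
    using v ri by (intro index_finsum_vec) auto
  moreover have "\<dots> = (\<Sum>j<i. v (j + 1) $ r * \<eta> (j + 1) (i + 1))"
  proof -
    have "(\<Sum>j\<in>{1..i}. (\<eta> j (i + 1) \<cdot>\<^sub>v v j) $ r) = (\<Sum>j\<in>{1..i}. v j $ r * \<eta> j (i + 1))"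
      using carrier_vecD[OF v] ri by (intro sum.cong) auto
    then show ?thesis by (simp add: sum.atLeast1_atMost_eq)
  qed
  moreover have "finsum_vec TYPE(real) n (\<lambda>j. \<eta> j (i + 1) \<cdot>\<^sub>v v j) {1..i} \<in> carrier_vec n"
    using v ri by (intro finsum_vec_closed) auto
  ultimately have L: "(transpose_mat A *\<^sub>v u (i + 1)) $ r
      = \<alpha> (i + 1) * v (i + 1) $ r + \<beta> (i + 1) * v i $ r
        + (\<Sum>j<i. v (j + 1) $ r * \<eta> (j + 1) (i + 1)) + g (i + 1) $ r"
    using carrier_vecD[OF v[of "i + 1"]] carrier_vecD[OF v[of i]] carrier_vecD[OF g] ri
    by auto
  have "(col_mat n v k * eta_mat \<alpha> \<beta> \<eta> k) $$ (r, i)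
      = (\<Sum>l<k. v (l + 1) $ r * eta_mat \<alpha> \<beta> \<eta> k $$ (l, i))"
    using ri carrier_matD[OF eta_mat_carrier] by (simp add: scalar_prod_def lessThan_atLeast0)
  also have "\<dots> = (\<Sum>l<k. (if l = i then v (l + 1) $ r * \<alpha> (i + 1) else 0)
      + (if l + 1 = i then v (l + 1) $ r * \<beta> (i + 1) else 0)
      + (if l < i then v (l + 1) $ r * \<eta> (l + 1) (i + 1) else 0))"
    using ri by (intro sum.cong) (auto simp: eta_mat_def distrib_left)
  also have "\<dots> = v (i + 1) $ r * \<alpha> (i + 1)
      + (\<Sum>l<k. if l + 1 = i then v (l + 1) $ r * \<beta> (i + 1) else 0)
      + (\<Sum>l<k. if l < i then v (l + 1) $ r * \<eta> (l + 1) (i + 1) else 0)"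
    using ri by (simp add: sum.distrib)
  \<comment> \<open>For \<open>i = 0\<close> no index qualifies, in agreement with
    \<open>v 0\<close> being zero; otherwise the surviving index is \<open>i - 1\<close>.\<close>
  also have "(\<Sum>l<k. if l + 1 = i then v (l + 1) $ r * \<beta> (i + 1) else 0) = v i $ r * \<beta> (i + 1)"
    using ri v0 by (cases i) simp_all
  also have "(\<Sum>l<k. if l < i then v (l + 1) $ r * \<eta> (l + 1) (i + 1) else 0)
      = (\<Sum>l<i. v (l + 1) $ r * \<eta> (l + 1) (i + 1))"
    using ri by (intro sum.mono_neutral_cong_right) auto
  finally have R: "(col_mat n v k * eta_mat \<alpha> \<beta> \<eta> k) $$ (r, i)
      = v (i + 1) $ r * \<alpha> (i + 1) + v i $ r * \<beta> (i + 1)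
      + (\<Sum>l<i. v (l + 1) $ r * \<eta> (l + 1) (i + 1))" .
  have "(transpose_mat A * col_mat m u k) $$ (r, i) = (transpose_mat A *\<^sub>v u (i + 1)) $ r"
    using A ri col_col_mat[of i k u m] u by simp
  also have "\<dots> = (col_mat n v k * eta_mat \<alpha> \<beta> \<eta> k) $$ (r, i) + g (i + 1) $ r"
    unfolding L R by (simp add: mult.commute)
  also have "\<dots> = ?R $$ (r, i)"
    using ri carrier_matD[OF eta_mat_carrier] by (simp del: index_mult_mat(1))
  finally show "(transpose_mat A * col_mat m u k) $$ (r, i) = ?R $$ (r, i)" .
qed (use assms carrier_matD[OF eta_mat_carrier[of \<alpha> \<beta> \<eta> k]] in \<open>auto simp: lbro_def\<close>)

text \<open>The upper triangle of \<open>U\<^sup>T A V\<close>, computed once from \<open>A V\<close> and once from \<open>A\<^sup>T U\<close>. In the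
  second computation \<open>C\<^sup>T T\<^sup>T\<close> is strictly lower triangular and \<open>C\<^sup>T\<close> contributes only the
  diagonal \<open>\<alpha>\<close>, which cancels.\<close>

lemma xi_mat_entry:
  assumes lbro: "lbro m n k A u v \<alpha> \<beta> \<xi> \<eta> f g" and ji: "j \<le> i" "i < k"
  defines "U \<equiv> col_mat m u (k + 1)" and "V \<equiv> col_mat n v k"
    and "S \<equiv> gram_defect m u (k + 1)" and "T \<equiv> gram_defect n v k"
    and "F \<equiv> col_mat m f k" and "G \<equiv> col_mat n g k"
    and "E \<equiv> bidiag \<alpha> \<beta> k + xi_mat \<xi> k" and "C \<equiv> eta_mat \<alpha> \<beta> \<eta> k"
  shows "xi_mat \<xi> k $$ (j, i) = ((S + transpose_mat S) * E) $$ (j, i) - (transpose_mat C * T) $$ (j, i)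
    + ((transpose_mat G * V) $$ (j, i) - (transpose_mat U * F) $$ (j, i))"
proof -
  \<comment> \<open>\<open>U\<close> has k + 1 columns, whereas the transposed recurrence is taken
    for the first k; as j <= i < k, column j is common to both.\<close>
  let ?Uk = "col_mat m u k"
  have A: "A \<in> carrier_mat m n" using lbro by (simp add: lbro_def)
  have car: "U \<in> carrier_mat m (k + 1)" "V \<in> carrier_mat n k" "F \<in> carrier_mat m k"
      "G \<in> carrier_mat n k" "S \<in> carrier_mat (k + 1) (k + 1)" "T \<in> carrier_mat k k"
      "C \<in> carrier_mat k k"
    unfolding U_def V_def F_def G_def S_def T_def C_def by (rule col_mat_carrier gram_defect_carrier eta_mat_carrier)+
  have E: "E \<in> carrier_mat (k + 1) k"
    unfolding E_def by (rule add_carrier_mat[OF xi_mat_carrier])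
  have uv: "u (j + 1) \<in> carrier_vec m" "v (i + 1) \<in> carrier_vec n"
    using lbro ji by (auto simp: lbro_def)
  have GU: "transpose_mat U * U = 1\<^sub>m (k + 1) - (S + transpose_mat S)"
    unfolding U_def S_def by (rule gram_eq) (use lbro in \<open>auto simp: lbro_def\<close>)
  have GV: "transpose_mat V * V = 1\<^sub>m k - (T + transpose_mat T)"
    unfolding V_def T_def by (rule gram_eq) (use lbro in \<open>auto simp: lbro_def\<close>)
  have "transpose_mat U * (A * V) = transpose_mat U * (U * E) + transpose_mat U * F"
    unfolding lbro_mult_A[OF lbro, folded U_def V_def F_def E_def]
    using car E by (intro mult_add_distrib_mat[of _ "k + 1" m _ k]) auto
  also have "transpose_mat U * (U * E) = (transpose_mat U * U) * E"
    using car E by (intro assoc_mult_mat[symmetric, of _ "k + 1" m _ "k + 1" _ k]) auto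
  also have "\<dots> = E - (S + transpose_mat S) * E"
    unfolding GU using car E by (subst minus_mult_distrib_mat[of _ "k + 1" "k + 1" _ _ k]) auto
  finally have left: "transpose_mat U * (A * V) = E - (S + transpose_mat S) * E + transpose_mat U * F" .
  have "transpose_mat (transpose_mat A * ?Uk) * V
      = (transpose_mat C * transpose_mat V + transpose_mat G) * V"
    unfolding lbro_mult_At[OF lbro, folded V_def G_def C_def]
    using car by (simp add: transpose_add[of _ n k] transpose_mult[of _ n k _ k])
  also have "\<dots> = transpose_mat C * transpose_mat V * V + transpose_mat G * V"
    using car by (intro add_mult_distrib_mat[of _ k n _ _ k]) auto
  also have "transpose_mat C * transpose_mat V * V = transpose_mat C * (transpose_mat V * V)"
    using car by (intro assoc_mult_mat[of _ k k _ n _ k]) auto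
  also have "\<dots> = transpose_mat C - (transpose_mat C * T + transpose_mat C * transpose_mat T)"
    unfolding GV using car
    by (simp add: mult_minus_distrib_mat[of _ k k _ k] mult_add_distrib_mat[of _ k k _ k])
  finally have right: "transpose_mat (transpose_mat A * ?Uk) * V
    = transpose_mat C - (transpose_mat C * T + transpose_mat C * transpose_mat T) + transpose_mat G * V" .
  have cols: "col U j = u (j + 1)" "col ?Uk j = u (j + 1)" "col V i = v (i + 1)"
    unfolding U_def V_def using ji uv by (auto intro!: col_col_mat)
  have "(transpose_mat U * (A * V)) $$ (j, i) = u (j + 1) \<bullet> (A *\<^sub>v v (i + 1))"
    using ji car A by (simp add: cols col_mult2[of A m n V k] del: col_mult)
  also have "\<dots> = (transpose_mat A *\<^sub>v u (j + 1)) \<bullet> v (i + 1)"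
    by (rule transpose_vec_mult_scalar[OF A uv(2,1), symmetric])
  also have "\<dots> = (transpose_mat (transpose_mat A * ?Uk) * V) $$ (j, i)"
    using ji car A
    by (simp add: cols col_mult2[of "transpose_mat A" n m ?Uk k] del: col_mult)
  finally have eq: "(transpose_mat U * (A * V)) $$ (j, i)
    = (transpose_mat (transpose_mat A * ?Uk) * V) $$ (j, i)" .
  have "(transpose_mat C * transpose_mat T) $$ (j, i) = (\<Sum>l<k. C $$ (l, j) * T $$ (i, l))"
    using ji car by (simp add: scalar_prod_def lessThan_atLeast0)
  also have "\<dots> = 0"
  \<comment> \<open>A nonzero entry of \<open>C\<close> needs l <= j and a nonzero entry of
    \<open>T\<close> needs l > i; both cannot hold, because j <= i.\<close>
  proof (rule sum.neutral, rule ballI)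
    fix l assume "l \<in> {..<k}"
    then have "C $$ (l, j) = 0 \<or> T $$ (i, l) = 0"
      using ji by (cases "l \<le> j") (auto simp: C_def eta_mat_def T_def gram_defect_def strict_upper_def)
    then show "C $$ (l, j) * T $$ (i, l) = 0" by auto
  qed
  finally have CT: "(transpose_mat C * transpose_mat T) $$ (j, i) = 0" .
  have "transpose_mat C $$ (j, i) = bidiag \<alpha> \<beta> k $$ (j, i)"
    using ji by (auto simp: C_def eta_mat_def bidiag_def)
  moreover have "E $$ (j, i) = bidiag \<alpha> \<beta> k $$ (j, i) + xi_mat \<xi> k $$ (j, i)"
    using ji carrier_matD[OF xi_mat_carrier] by (simp add: E_def)
  ultimately show ?thesis
    using eq[unfolded left right] CT ji car E
    by (simp del: index_mult_mat(1) add: carrier_matD[OF car(1)] carrier_matD[OF car(2)])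
qed

section \<open>Frobenius bounds for the coefficient matrices\<close>

lemma fro_norm_unit_cols:
  assumes "\<And>i. i \<in> {1..N} \<Longrightarrow> w i \<in> carrier_vec d \<and> vec_norm (w i) = 1"
  shows "fro_norm (col_mat d w N) \<le> sqrt (real N)"
  using fro_norm_le_of_cols[of 1 "col_mat d w N"] assms by (simp add: col_col_mat[of _ N w d, simplified])

text \<open>Every column is dominated by the operator norm of a \<open>col_mat\<close> containing
  it. The larger \<open>N'\<close> lets the bound assumed for k + 1 columns of \<open>g\<close> be
  used for the first k.\<close>

lemma fro_norm_col_mat_le:
  assumes w: "\<And>i. i \<in> {1..N} \<Longrightarrow> w i \<in> carrier_vec d" and "N \<le> N'"
  shows "fro_norm (col_mat d w N) \<le> sqrt (real N) * mat_norm (col_mat d w N')"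
proof -
  have "vec_norm (col (col_mat d w N) j) \<le> mat_norm (col_mat d w N')" if "j < N" for j
    using vec_norm_le_mat_norm_col_mat[of j N' w d] col_col_mat[of j N w d] w[of "j + 1"] that \<open>N \<le> N'\<close>
    by simp
  then show ?thesis
    using fro_norm_le_of_cols[of "mat_norm (col_mat d w N')" "col_mat d w N"] by simp
qed

lemma mat_norm_col_mat_le:
  assumes "\<And>i. i \<in> {1..N} \<Longrightarrow> w i \<in> carrier_vec d \<and> vec_norm (w i) = 1"
    and "orth_level d w N \<le> 1 / 4"
  shows "mat_norm (col_mat d w N) \<le> 2"
proof (rule mat_norm_le)
  fix x :: "real vec" assume "x \<in> carrier_vec (dim_col (col_mat d w N))"
  then show "vec_norm (col_mat d w N *\<^sub>v x) \<le> 2 * vec_norm x"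
    by (intro vec_norm_col_mat_bounds(2)) (use assms in auto)
qed simp

lemma fro_norm_le_col_mat_mult:
  assumes "\<And>i. i \<in> {1..N} \<Longrightarrow> w i \<in> carrier_vec d \<and> vec_norm (w i) = 1"
    and "orth_level d w N \<le> 1 / 4" and "M \<in> carrier_mat N c"
  shows "fro_norm M \<le> 2 * fro_norm (col_mat d w N * M)"
  by (rule fro_norm_le_mult[OF col_mat_carrier assms(3)])
    (use assms in \<open>auto intro: vec_norm_col_mat_bounds(1)\<close>)

text \<open>Restriction to the upper triangle does not increase the Frobenius norm; for the operator norm
  this fails, by a factor growing logarithmically with the dimension.\<close>

lemma xi_mat_fro_norm_le:
  assumes lbro: "lbro m n k A u v \<alpha> \<beta> \<xi> \<eta> f g"
  defines "U \<equiv> col_mat m u (k + 1)" and "V \<equiv> col_mat n v k"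
    and "S \<equiv> gram_defect m u (k + 1)" and "T \<equiv> gram_defect n v k"
    and "F \<equiv> col_mat m f k" and "G \<equiv> col_mat n g k"
    and "E \<equiv> bidiag \<alpha> \<beta> k + xi_mat \<xi> k" and "C \<equiv> eta_mat \<alpha> \<beta> \<eta> k"
  shows "fro_norm (xi_mat \<xi> k) \<le> 2 * mat_norm S * fro_norm E + mat_norm T * fro_norm C
    + (mat_norm V * fro_norm G + mat_norm U * fro_norm F)"
proof -
  have car: "U \<in> carrier_mat m (k + 1)" "V \<in> carrier_mat n k" "F \<in> carrier_mat m k"
      "G \<in> carrier_mat n k" "S \<in> carrier_mat (k + 1) (k + 1)" "T \<in> carrier_mat k k"
      "C \<in> carrier_mat k k"
    unfolding U_def V_def F_def G_def S_def T_def C_def by (rule col_mat_carrier gram_defect_carrier eta_mat_carrier)+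
  have E: "E \<in> carrier_mat (k + 1) k"
    unfolding E_def by (rule add_carrier_mat[OF xi_mat_carrier])
  \<comment> \<open>The upper triangle in 0-based indices. It lies in both the k x k and the (k + 1)
    x k index ranges, so all four matrices below can be restricted to it.\<close>
  define I where "I = {(j, i). j \<le> i \<and> i < k}"
  have I: "I \<subseteq> {..<k} \<times> {..<k}" "I \<subseteq> {..<k + 1} \<times> {..<k}"
    by (auto simp: I_def)
  let ?N = "\<lambda>M. L2_set (\<lambda>p. M $$ p) I"
  let ?M1 = "(S + transpose_mat S) * E" and ?M2 = "transpose_mat C * T"
  let ?M3 = "transpose_mat G * V" and ?M4 = "transpose_mat U * F"
  have "fro_norm (xi_mat \<xi> k) = ?N (xi_mat \<xi> k)"
    unfolding fro_norm_def L2_set_def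
    using carrier_matD[OF xi_mat_carrier[of \<xi> k]] I(2)
    by (intro arg_cong[of _ _ sqrt] sum.mono_neutral_right) (auto simp: I_def xi_mat_def)
  also have "\<dots> = L2_set (\<lambda>p. (?M1 $$ p + - ?M2 $$ p) + (?M3 $$ p + - ?M4 $$ p)) I"
    using xi_mat_entry[OF lbro] unfolding U_def V_def S_def T_def F_def G_def E_def C_def
    by (intro L2_set_cong) (auto simp: I_def simp del: index_mult_mat(1))
  also have "\<dots> \<le> (?N ?M1 + ?N ?M2) + (?N ?M3 + ?N ?M4)"
  proof -
    have uminus: "L2_set (\<lambda>p. - h p) I = L2_set h I" for h :: "nat \<times> nat \<Rightarrow> real"
      by (simp add: L2_set_def)
    show ?thesis
      by (intro order_trans[OF L2_set_triangle_ineq] add_mono)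
        (auto intro: order_trans[OF L2_set_triangle_ineq] simp: uminus)
  qed
  also have "\<dots> \<le> (2 * mat_norm S * fro_norm E + mat_norm T * fro_norm C)
      + (mat_norm V * fro_norm G + mat_norm U * fro_norm F)"
  proof (intro add_mono)
    have M1: "?M1 = S * E + transpose_mat S * E"
      using car E by (intro add_mult_distrib_mat[of _ "k + 1" "k + 1" _ _ k]) auto
    have "?N ?M1 \<le> fro_norm ?M1"
      using I car E by (intro L2_set_le_fro_norm) auto
    also have "\<dots> \<le> fro_norm (S * E) + fro_norm (transpose_mat S * E)"
      unfolding M1 using car E by (intro fro_norm_add_le[of _ "k + 1" k]) auto
    also have "\<dots> \<le> mat_norm S * fro_norm E + mat_norm S * fro_norm E"
      using car E mat_norm_transpose_le[of S]
      by (intro add_mono fro_norm_mult_le[of _ "k + 1" "k + 1" _ k]) auto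
    finally show "?N ?M1 \<le> 2 * mat_norm S * fro_norm E"
      by (simp only: mult_2 distrib_right)
    have "?N ?M2 \<le> fro_norm ?M2"
      using I car by (intro L2_set_le_fro_norm) auto
    also have "\<dots> \<le> mat_norm T * fro_norm (transpose_mat C)"
      using car by (intro fro_norm_mult_le_right[of _ k k _ k]) auto
    finally show "?N ?M2 \<le> mat_norm T * fro_norm C" by simp
    have "?N ?M3 \<le> fro_norm ?M3"
      using I car by (intro L2_set_le_fro_norm) auto
    also have "\<dots> \<le> mat_norm V * fro_norm (transpose_mat G)"
      using car by (intro fro_norm_mult_le_right[of _ k n _ k]) auto
    finally show "?N ?M3 \<le> mat_norm V * fro_norm G" by simp
    have "?N ?M4 \<le> fro_norm ?M4"
      using I car by (intro L2_set_le_fro_norm) auto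
    also have "\<dots> \<le> mat_norm U * fro_norm F"
      using car mat_norm_transpose_le[of U] by (intro fro_norm_mult_le[of _ "k + 1" m _ k]) auto
    finally show "?N ?M4 \<le> mat_norm U * fro_norm F" .
  qed
  finally show ?thesis by simp
qed

section \<open>The backward error\<close>

text \<open>Subtracting (0; A V), with A V = U (B + D) + F, from the image of (B; 0) leaves -U c - U
  (B + D) - F below. \<open>B\<close> and \<open>c\<close> are grouped because their sum is small
  while each alone may be large.\<close>

lemma X_mat_decomp:
  assumes lbro: "lbro m n k A u v \<alpha> \<beta> \<xi> \<eta> f g" and k: "k \<le> n"
  shows "\<exists>c \<in> carrier_mat (k + 1) k. gram_defect m u (k + 1) * c = bidiag \<alpha> \<beta> k + c \<and>
    X_mat m n A u v \<alpha> \<beta> k = (bidiag \<alpha> \<beta> k + c) @\<^sub>r (0\<^sub>m (n - k) k @\<^sub>r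
      - (col_mat m u (k + 1) * ((bidiag \<alpha> \<beta> k + c) + xi_mat \<xi> k) + col_mat m f k))"
proof -
  let ?B = "bidiag \<alpha> \<beta> k" and ?U = "col_mat m u (k + 1)" and ?D = "xi_mat \<xi> k" and ?F = "col_mat m f k"
  let ?X = "X_mat m n A u v \<alpha> \<beta> k"
  have A: "A \<in> carrier_mat m n" and u: "\<And>i. i \<in> {1..k + 1} \<Longrightarrow> u i \<in> carrier_vec m"
    and v: "\<And>i. i \<in> {1..k} \<Longrightarrow> v i \<in> carrier_vec n"
    using lbro by (auto simp: lbro_def)
  obtain c where c: "c \<in> carrier_mat (k + 1) k" and Sc: "gram_defect m u (k + 1) * c = ?B + c"
    and Pc: "P_hat m n u (k + 1) * (?B @\<^sub>r 0\<^sub>m (m + n - k) k)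
      = (?B + c) @\<^sub>r (0\<^sub>m (n - k) k @\<^sub>r - (?U * c))"
    using P_hat_append_rows[OF _ k bidiag_carrier[of \<alpha> \<beta> k], of u m] u by blast
  have B: "?B \<in> carrier_mat (k + 1) k" and D: "?D \<in> carrier_mat (k + 1) k"
    and U: "?U \<in> carrier_mat m (k + 1)" and F: "?F \<in> carrier_mat m k"
    by (rule bidiag_carrier xi_mat_carrier col_mat_carrier)+
  have BC: "?B + c \<in> carrier_mat (k + 1) k" using c by simp
  have Y: "- (?U * ((?B + c) + ?D) + ?F) \<in> carrier_mat m k"
    using U F by auto
  have Uc: "- (?U * c) \<in> carrier_mat m k" using U c by auto
  have AV: "A * col_mat n v k \<in> carrier_mat m k" using A by auto
  have X': "(?B + c) @\<^sub>r (0\<^sub>m (n - k) k @\<^sub>r - (?U * ((?B + c) + ?D) + ?F)) \<in> carrier_mat (m + n + 1) k"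
    using carrier_append_rows[OF BC carrier_append_rows[OF zero_carrier_mat Y, of "n - k"]] k
    by (simp add: add.commute[of n m])
  have "?X = (?B + c) @\<^sub>r (0\<^sub>m (n - k) k @\<^sub>r - (?U * ((?B + c) + ?D) + ?F))" (is "_ = ?X'")
  proof (rule eq_matI)
    fix i j assume "i < dim_row ?X'" "j < dim_col ?X'"
    then have ij: "i < m + n + 1" "j < k" using carrier_matD[OF X'] by auto
    have "(0\<^sub>m (n + 1) k @\<^sub>r (A * col_mat n v k)) $$ (i, j) + ?X $$ (i, j)
        = ((0\<^sub>m (n + 1) k @\<^sub>r (A * col_mat n v k)) + ?X) $$ (i, j)"
      using ij carrier_matD[OF X_mat_carrier[of m n A u v \<alpha> \<beta> k]] by simp
    also have "\<dots> = ((?B + c) @\<^sub>r (0\<^sub>m (n - k) k @\<^sub>r - (?U * c))) $$ (i, j)"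
      using X_mat_identity[of A m n k u v \<alpha> \<beta>] A u v k by (simp only: Pc)
    finally have eq: "(0\<^sub>m (n + 1) k @\<^sub>r (A * col_mat n v k)) $$ (i, j) + ?X $$ (i, j)
      = ((?B + c) @\<^sub>r (0\<^sub>m (n - k) k @\<^sub>r - (?U * c))) $$ (i, j)" .
    have low: "(- (?U * c)) $$ (r, j)
        = (A * col_mat n v k) $$ (r, j) + (- (?U * ((?B + c) + ?D) + ?F)) $$ (r, j)" if "r < m" for r
    proof -
      have "A * col_mat n v k = ?U * ?B + ?U * ?D + ?F"
        using lbro_mult_A[OF lbro] mult_add_distrib_mat[OF U B D] by simp
      moreover have "?U * ((?B + c) + ?D) = ?U * ?B + ?U * c + ?U * ?D"
        using mult_add_distrib_mat[OF U BC D] mult_add_distrib_mat[OF U B c] by simp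
      moreover have "?U * ?B \<in> carrier_mat m k" "?U * c \<in> carrier_mat m k" "?U * ?D \<in> carrier_mat m k"
        using U B c D by auto
      ultimately show ?thesis
        using that ij F by (auto simp del: index_mult_mat(1))
    qed
    \<comment> \<open>The rows fall into the first k + 1, the zero rows up to n, and the m rows of
      the lower block; \<open>A V\<close> enters only in the last range.\<close>
    show "?X $$ (i, j) = ?X' $$ (i, j)"
      using eq low[of "i - (n + 1)"] ij k
        append_rows_index[OF zero_carrier_mat AV, of i "n + 1" j]
        append_rows3_index[OF BC zero_carrier_mat Y, of i "n - k" j]
        append_rows3_index[OF BC zero_carrier_mat Uc, of i "n - k" j]
      by (auto split: if_splits simp del: index_mult_mat(1) index_uminus_mat(1))
  qed (use carrier_matD[OF X'] carrier_matD[OF X_mat_carrier[of m n A u v \<alpha> \<beta> k]] in auto)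
  with c Sc show ?thesis by blast
qed

text \<open>This is sharper than the final bound: \<open>ur\<close> and the level of the family
  \<open>v\<close> come without the factor k. The factor sqrt k is the price of Frobenius norms of
  matrices with k columns.\<close>

lemma X_mat_norm_le:
  assumes lbro: "lbro m n k A u v \<alpha> \<beta> \<xi> \<eta> f g" and k: "k \<le> n"
    and L: "0 \<le> L" and ur: "0 \<le> ur" "ur \<le> 1 / 4"
    and F_le: "mat_norm (col_mat m f k) \<le> L * (mat_norm A * ur)"
    and G_le: "mat_norm (col_mat n g (k + 1)) \<le> L * (mat_norm A * ur)"
    and \<mu>: "orth_level m u (k + 1) \<le> 1 / 4" and \<nu>: "orth_level n v k \<le> 1 / 4"
  shows "mat_norm (X_mat m n A u v \<alpha> \<beta> k) \<le> 39 * (1 + L) * (mat_norm A * sqrt (real k))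
    * (ur + orth_level n v k + orth_level m u (k + 1))"
proof -
  let ?B = "bidiag \<alpha> \<beta> k" and ?U = "col_mat m u (k + 1)" and ?D = "xi_mat \<xi> k" and ?F = "col_mat m f k"
  let ?V = "col_mat n v k" and ?Uk = "col_mat m u k" and ?G = "col_mat n g k"
  let ?C = "eta_mat \<alpha> \<beta> \<eta> k" and ?E = "bidiag \<alpha> \<beta> k + xi_mat \<xi> k"
  let ?S = "gram_defect m u (k + 1)"
  let ?X = "X_mat m n A u v \<alpha> \<beta> k"
  define M where "M = orth_level m u (k + 1)"
  define N where "N = orth_level n v k"
  define q where "q = mat_norm A * sqrt (real k)"
  \<comment> \<open>One scale for all estimates: \<open>w\<close> dominates \<open>q\<close>
    together with the rounding errors.\<close>
  define w where "w = (1 + L) * q"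
  have A: "A \<in> carrier_mat m n" and f: "\<And>i. i \<in> {1..k} \<Longrightarrow> f i \<in> carrier_vec m"
    and g: "\<And>i. i \<in> {1..k} \<Longrightarrow> g i \<in> carrier_vec n"
    and u: "\<And>i. i \<in> {1..k + 1} \<Longrightarrow> u i \<in> carrier_vec m \<and> vec_norm (u i) = 1"
    and v: "\<And>i. i \<in> {1..k} \<Longrightarrow> v i \<in> carrier_vec n \<and> vec_norm (v i) = 1"
    using lbro by (auto simp: lbro_def)
  have S: "mat_norm ?S = M" and T: "mat_norm (gram_defect n v k) = N"
    by (simp_all add: M_def N_def orth_level_def gram_defect_def)
  have nn: "0 \<le> M" "0 \<le> N" "0 \<le> q" "0 \<le> w"
    using L mat_norm_nonneg[of ?S, unfolded S] mat_norm_nonneg[of "gram_defect n v k", unfolded T]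
    by (simp_all add: q_def w_def)
  have MN: "M \<le> 1 / 4" "N \<le> 1 / 4" using \<mu> \<nu> by (simp_all add: M_def N_def)
  have "fro_norm ?F \<le> sqrt (real k) * mat_norm ?F"
    by (rule fro_norm_col_mat_le) (use f in auto)
  also have "\<dots> \<le> sqrt (real k) * (L * (mat_norm A * ur))"
    by (intro mult_left_mono F_le) simp
  finally have FL: "fro_norm ?F \<le> L * q * ur"
    by (simp add: q_def ac_simps)
  have "fro_norm ?G \<le> sqrt (real k) * mat_norm (col_mat n g (k + 1))"
    by (rule fro_norm_col_mat_le) (use g in auto)
  also have "\<dots> \<le> sqrt (real k) * (L * (mat_norm A * ur))"
    by (intro mult_left_mono G_le) simp
  finally have GL: "fro_norm ?G \<le> L * q * ur"
    by (simp add: q_def ac_simps)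
  have "L * q * ur \<le> w * ur"
    using nn ur by (intro mult_right_mono) (simp_all add: w_def algebra_simps)
  with FL GL have F: "fro_norm ?F \<le> w * ur" and G: "fro_norm ?G \<le> w * ur"
    by auto
  have qw: "q + L * q * ur \<le> w"
    using mult_left_mono[of ur 1 "L * q"] nn L ur by (simp add: w_def algebra_simps)
  \<comment> \<open>The factor 2 is the conditioning of \<open>U\<close>, and
    \<open>U E = A V - F\<close> has norm at most q + L q ur <= w.\<close>
  have E: "fro_norm ?E \<le> 2 * w"
  proof -
    have "fro_norm ?E \<le> 2 * fro_norm (?U * ?E)"
      by (rule fro_norm_le_col_mat_mult[OF u \<mu> add_carrier_mat[OF xi_mat_carrier]])
    also have "?U * ?E = A * ?V - ?F"
      unfolding lbro_mult_A[OF lbro] using carrier_matD[OF xi_mat_carrier[of \<xi> k]]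
      by (intro eq_matI) (auto simp del: index_mult_mat(1))
    also have "fro_norm \<dots> \<le> fro_norm (A * ?V) + fro_norm ?F"
      using A by (intro fro_norm_diff_le[of _ m k]) auto
    also have "fro_norm (A * ?V) \<le> mat_norm A * fro_norm ?V"
      by (rule fro_norm_mult_le[OF A col_mat_carrier]) simp
    also have "mat_norm A * fro_norm ?V \<le> q"
      unfolding q_def by (intro mult_left_mono fro_norm_unit_cols v) auto
    finally have "fro_norm ?E \<le> 2 * (q + fro_norm ?F)" by simp
    also have "\<dots> \<le> 2 * w"
      using order_trans[OF add_left_mono[OF FL] qw] by simp
    finally show ?thesis .
  qed
  have C: "fro_norm ?C \<le> 2 * w"
  proof -
    have "fro_norm ?C \<le> 2 * fro_norm (?V * ?C)"
      by (rule fro_norm_le_col_mat_mult[OF v \<nu> eta_mat_carrier])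
    also have "?V * ?C = transpose_mat A * ?Uk - ?G"
      unfolding lbro_mult_At[OF lbro] using carrier_matD[OF eta_mat_carrier[of \<alpha> \<beta> \<eta> k]]
      by (intro eq_matI) (auto simp del: index_mult_mat(1))
    also have "fro_norm \<dots> \<le> fro_norm (transpose_mat A * ?Uk) + fro_norm ?G"
      using A by (intro fro_norm_diff_le[of _ n k]) auto
    also have "fro_norm (transpose_mat A * ?Uk) \<le> mat_norm A * fro_norm ?Uk"
      using A by (intro fro_norm_mult_le[OF _ col_mat_carrier, of _ n] mat_norm_transpose_le) auto
    also have "mat_norm A * fro_norm ?Uk \<le> q"
      unfolding q_def by (intro mult_left_mono fro_norm_unit_cols u) auto
    finally have "fro_norm ?C \<le> 2 * (q + fro_norm ?G)" by simp
    also have "\<dots> \<le> 2 * w"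
      using order_trans[OF add_left_mono[OF GL] qw] by simp
    finally show ?thesis .
  qed
  have U2: "mat_norm ?U \<le> 2" and V2: "mat_norm ?V \<le> 2"
    using mat_norm_col_mat_le[OF u \<mu>] mat_norm_col_mat_le[OF v \<nu>] by auto
  have D: "fro_norm ?D \<le> 4 * w * (ur + N + M)"
  proof -
    have "fro_norm ?D \<le> 2 * M * fro_norm ?E + N * fro_norm ?C
        + (mat_norm ?V * fro_norm ?G + mat_norm ?U * fro_norm ?F)"
      using xi_mat_fro_norm_le[OF lbro] unfolding S T .
    also have "\<dots> \<le> 2 * M * (2 * w) + N * (2 * w) + (2 * (w * ur) + 2 * (w * ur))"
      using nn ur E C F G U2 V2 by (intro add_mono mult_mono) auto
    also have "\<dots> \<le> 4 * w * (ur + N + M)"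
      using nn by (simp add: algebra_simps)
    finally show ?thesis .
  qed
  \<comment> \<open>Each of the three small quantities is at most 1/4; the crude bound 3 w serves to
    bound \<open>B\<close>.\<close>
  have "4 * w * (ur + N + M) \<le> 4 * w * (3 / 4)"
    using MN ur nn by (intro mult_left_mono) auto
  then have D3: "fro_norm ?D \<le> 3 * w" using D by simp
  have "?E - ?D = ?B"
    using carrier_matD[OF xi_mat_carrier[of \<xi> k]] carrier_matD[OF bidiag_carrier[of \<alpha> \<beta> k]]
    by (intro eq_matI) auto
  then have "fro_norm ?B \<le> fro_norm ?E + fro_norm ?D"
    using fro_norm_diff_le[OF add_carrier_mat[OF xi_mat_carrier] xi_mat_carrier, of ?B \<xi> k \<xi>]
    by simp
  then have B: "fro_norm ?B \<le> 5 * w" using E D3 by simp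
  obtain c where c: "c \<in> carrier_mat (k + 1) k" and Sc: "?S * c = ?B + c"
    and X: "?X = (?B + c) @\<^sub>r (0\<^sub>m (n - k) k @\<^sub>r - (?U * ((?B + c) + ?D) + ?F))"
    using X_mat_decomp[OF lbro k] by blast
  have Z: "fro_norm (?B + c) \<le> M * fro_norm c"
    unfolding Sc[symmetric] by (intro fro_norm_mult_le[OF gram_defect_carrier c] eq_refl S)
  have "(?B + c) - ?B = c"
    using c carrier_matD[OF bidiag_carrier[of \<alpha> \<beta> k]] by (intro eq_matI) auto
  then have "fro_norm c \<le> fro_norm (?B + c) + fro_norm ?B"
    using fro_norm_diff_le[OF add_carrier_mat[OF c] bidiag_carrier, of ?B \<alpha> \<beta>] by simp
  moreover have "M * fro_norm c \<le> 1 / 4 * fro_norm c"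
    using MN by (intro mult_right_mono) auto
  \<comment> \<open>From |c| <= |c| / 4 + 5 w follows |c| <= 20 w / 3, rounded up to 10 w.\<close>
  ultimately have "fro_norm c \<le> 10 * w" using Z B nn by simp
  \<comment> \<open>Feeding this back into |B + c| <= M |c| makes the upper block first order in the
    orthogonality level.\<close>
  then have Z10: "fro_norm (?B + c) \<le> 10 * w * M"
    using Z mult_left_mono[of "fro_norm c" "10 * w" M] nn by (simp add: ac_simps)
  have BC: "?B + c \<in> carrier_mat (k + 1) k"
    using c by (rule add_carrier_mat)
  have Y: "- (?U * ((?B + c) + ?D) + ?F) \<in> carrier_mat m k"
    by (intro uminus_carrier_mat add_carrier_mat col_mat_carrier)
  have "mat_norm ?X \<le> fro_norm ?X" by (rule mat_norm_le_fro)
  also have "\<dots> \<le> fro_norm (?B + c) + (fro_norm (0\<^sub>m (n - k) k :: real mat)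
      + fro_norm (- (?U * ((?B + c) + ?D) + ?F)))"
    unfolding X
    by (rule order_trans[OF fro_norm_append_rows[OF BC carrier_append_rows[OF zero_carrier_mat Y]]])
      (intro add_left_mono fro_norm_append_rows[OF zero_carrier_mat Y])
  also have "\<dots> = fro_norm (?B + c) + fro_norm (?U * ((?B + c) + ?D) + ?F)"
    by simp
  also have "\<dots> \<le> fro_norm (?B + c) + (2 * (fro_norm (?B + c) + fro_norm ?D) + fro_norm ?F)"
  proof (intro add_left_mono)
    have "fro_norm (?U * ((?B + c) + ?D) + ?F) \<le> fro_norm (?U * ((?B + c) + ?D)) + fro_norm ?F"
      by (rule fro_norm_add_le[OF mult_carrier_mat[OF col_mat_carrier
            add_carrier_mat[OF xi_mat_carrier]] col_mat_carrier])
    also have "fro_norm (?U * ((?B + c) + ?D)) \<le> 2 * fro_norm ((?B + c) + ?D)"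
      by (rule fro_norm_mult_le[OF col_mat_carrier add_carrier_mat[OF xi_mat_carrier] U2])
    also have "fro_norm ((?B + c) + ?D) \<le> fro_norm (?B + c) + fro_norm ?D"
      by (rule fro_norm_add_le[OF BC xi_mat_carrier])
    finally show "fro_norm (?U * ((?B + c) + ?D) + ?F)
      \<le> 2 * (fro_norm (?B + c) + fro_norm ?D) + fro_norm ?F" by simp
  qed
  also have "\<dots> \<le> 10 * w * M + (2 * (10 * w * M + 4 * w * (ur + N + M)) + w * ur)"
    by (intro add_mono mult_left_mono Z10 D F) simp_all
  \<comment> \<open>The coefficients of w are 38 for M, 8 for N and 9 for ur.\<close>
  also have "\<dots> \<le> 39 * w * (ur + N + M)"
    using nn ur by (simp add: algebra_simps)
  finally show ?thesis
    by (simp only: w_def q_def M_def N_def mult.assoc)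
qed

text \<open>The constants are chosen before the dimensions and all computed quantities, so they can
  depend on \<open>K\<close> only. The smallness conditions guard the estimate but not the exact
  identity.\<close>

theorem theorem3p1:
  fixes K :: real
  shows "\<exists>C>0. \<exists>\<epsilon>\<^sub>0>0. \<forall>m n k A ur u v \<alpha> \<beta> \<xi> \<eta> f g.
    n < m \<longrightarrow> 1 \<le> k \<longrightarrow> k \<le> n \<longrightarrow> 0 < ur \<longrightarrow>
    lbro m n k A u v \<alpha> \<beta> \<xi> \<eta> f g \<longrightarrow>
    mat_norm (col_mat m f k) \<le> K * (mat_norm A * ur) \<longrightarrow>
    mat_norm (col_mat n g (k + 1)) \<le> K * (mat_norm A * ur) \<longrightarrow>
    orth_level m u (k + 1) < 1 / 2 \<longrightarrow>
    orth_level n v k < 1 / 2 \<longrightarrow>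
    (0\<^sub>m (n + 1) k @\<^sub>r (A * col_mat n v k)) + X_mat m n A u v \<alpha> \<beta> k
      = P_hat m n u (k + 1) * (bidiag \<alpha> \<beta> k @\<^sub>r 0\<^sub>m (m + n - k) k) \<and>
    (ur \<le> \<epsilon>\<^sub>0 \<longrightarrow> orth_level m u (k + 1) \<le> \<epsilon>\<^sub>0 \<longrightarrow> orth_level n v k \<le> \<epsilon>\<^sub>0 \<longrightarrow>
      mat_norm (X_mat m n A u v \<alpha> \<beta> k)
        \<le> C * (mat_norm A * sqrt (real k)
               * (real k * ur + real k * orth_level n v k + orth_level m u (k + 1))))"
\<comment> \<open>The constant is that of \<open>X_mat_norm_le\<close> with L = |K|, as L must be
  nonnegative while \<open>K\<close> is any real; 1/4 is the threshold of the conditioning lemmas.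
  Rotating the conjunctions leaves positivity of both witnesses to the end.\<close>
proof (rule exI[of _ "39 * (1 + \<bar>K\<bar>)"], rule conjI[rotated],
    rule exI[of _ "1 / 4"], rule conjI[rotated], intro allI impI conjI)
  fix m n k A and ur :: real and u v \<alpha> \<beta> \<xi> \<eta> f g
  assume k: "1 \<le> k" "k \<le> n" and ur: "0 < ur"
    and lbro: "lbro m n k A u v \<alpha> \<beta> \<xi> \<eta> f g"
    and F: "mat_norm (col_mat m f k) \<le> K * (mat_norm A * ur)"
    and G: "mat_norm (col_mat n g (k + 1)) \<le> K * (mat_norm A * ur)"
  show "(0\<^sub>m (n + 1) k @\<^sub>r (A * col_mat n v k)) + X_mat m n A u v \<alpha> \<beta> k
      = P_hat m n u (k + 1) * (bidiag \<alpha> \<beta> k @\<^sub>r 0\<^sub>m (m + n - k) k)"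
    by (rule X_mat_identity) (use lbro k in \<open>auto simp: lbro_def\<close>)
  assume small: "ur \<le> 1 / 4" "orth_level m u (k + 1) \<le> 1 / 4" "orth_level n v k \<le> 1 / 4"
  have K: "K * (mat_norm A * ur) \<le> \<bar>K\<bar> * (mat_norm A * ur)"
    using ur by (intro mult_right_mono) auto
  have "mat_norm (X_mat m n A u v \<alpha> \<beta> k) \<le> 39 * (1 + \<bar>K\<bar>) * (mat_norm A * sqrt (real k))
      * (ur + orth_level n v k + orth_level m u (k + 1))"
    by (rule X_mat_norm_le[OF lbro k(2)]) (use ur small order_trans[OF F K] order_trans[OF G K] in auto)
  \<comment> \<open>Here 1 <= k pays for the factors k in front of \<open>ur\<close> and
    \<open>orth_level n v k\<close>.\<close>
  also have "\<dots> \<le> 39 * (1 + \<bar>K\<bar>) * (mat_norm A * sqrt (real k))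
      * (real k * ur + real k * orth_level n v k + orth_level m u (k + 1))"
  proof (intro mult_left_mono add_right_mono add_mono)
    have "0 \<le> orth_level n v k" by (simp add: orth_level_def)
    then show "ur \<le> real k * ur" "orth_level n v k \<le> real k * orth_level n v k"
      using k ur by (simp_all add: mult_le_cancel_right1)
  qed simp
  finally show "mat_norm (X_mat m n A u v \<alpha> \<beta> k) \<le> 39 * (1 + \<bar>K\<bar>) * (mat_norm A * sqrt (real k)
      * (real k * ur + real k * orth_level n v k + orth_level m u (k + 1)))"
    by (simp add: mult.assoc)
qed auto

end
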